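(* Let $R$ be a unital commutative ring and let $\mathscr{O}$ be a binary operad in $R$-modules. Then, for every free $R$-module $V$ of finite rank with $\mathrm{rank}_R(V)\neq 1$, the inclusion $$\mathrm{Der}^{(1)}_{\mathrm{preLie}}(\mathscr{O}(V))\hookrightarrow \mathrm{Der}^+(\mathscr{O}(V))$$ is an isomorphism.
   Context: Operads are symmetric operads in $R$-modules. A binary operad is an operad generated by operations of arity two: there is a set $B$ and a surjective morphism of operads onto $\mathscr{O}$ from the free operad on the set $B$ of generators of arity $2$ (no symmetry imposed on generators); in particular $\mathscr{O}(0)=0$ and $\mathscr{O}(1)$ is generated by the unit. For an $R$-module $V$, $\mathscr{O}(V)=\bigoplus_n\mathscr{O}_n(V)$, $\mathscr{O}_n(V)=\mathscr{O}(n)\otimes_{\mathfrak{S}_n}V^{\otimes n}$, is the free $\mathscr{O}$-algebra on $V$. For $V$ free of finite rank, $\mathrm{Der}(\mathscr{O}(V))$ is the $R$-module of derivations of the $\mathscr{O}$-algebra $\mathscr{O}(V)$, i.e. $R$-linear maps $d$ with $d(\mu(a_1,\dots,a_n))=\sum_i\mu(a_1,\dots,d(a_i),\dots,a_n)$ for $\mu\in\mathscr{O}(n)$; restriction to $V$ gives $\mathrm{Der}(\mathscr{O}(V))\cong\mathrm{Hom}_R(V,\mathscr{O}(V))$. It is graded with $\mathrm{Der}^{n-1}(\mathscr{O}(V))\cong\mathrm{Hom}_R(V,\mathscr{O}_n(V))$, and $\mathrm{Der}^+(\mathscr{O}(V))$ is the submodule of elements of positive degree, $\bigoplus_{n\ge2}\mathrm{Hom}_R(V,\mathscr{O}_n(V))$.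 For derivations $d,e$, $d\lhd e$ is the derivation determined by $(d\lhd e)|_V=e\circ(d|_V)$; $\lhd$ is a preLie product (its associator is right symmetric: $u\lhd(v\lhd w)-(u\lhd v)\lhd w=u\lhd(w\lhd v)-(u\lhd w)\lhd v$). $\mathrm{Der}^{(1)}_{\mathrm{preLie}}(\mathscr{O}(V))$ is the sub preLie algebra of $(\mathrm{Der}(\mathscr{O}(V)),\lhd)$ generated by the degree one part $\mathrm{Der}^1(\mathscr{O}(V))\cong\mathrm{Hom}_R(V,\mathscr{O}_2(V))$; it is contained in $\mathrm{Der}^+(\mathscr{O}(V))$. *)

theory Defs
  imports
    Complex_Main
    "HOL-Library.FuncSet"
    "HOL-Library.Poly_Mapping"
    "HOL-Combinatorics.Permutations"
begin

section \<open>Symmetric operads in modules\<close>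

text \<open>
  The modules of operations form a family of submodules of one ambient module on the type
  \<^typ>\<open>'o\<close>. No family of modules is lost in this way (take the ambient module to be their direct
  sum). The submodules need not be independent, so the structure maps carry the arities as
  arguments: \<open>op_comp P [n\<^sub>1, \<dots>, n\<^sub>k] \<mu> [\<nu>\<^sub>1, \<dots>, \<nu>\<^sub>k]\<close> is \<open>\<mu>(\<nu>\<^sub>1, \<dots>, \<nu>\<^sub>k)\<close>
  for \<open>\<mu>\<close> of arity \<open>k\<close> and \<open>\<nu>\<^sub>i\<close> of arity \<open>n\<^sub>i\<close>.

  Inputs are numbered from \<open>0\<close>, and the symmetric group on \<open>n\<close> letters consists of the
  permutations of \<open>{..<n}\<close>. It acts on the right, \<open>op_act P n \<sigma> \<mu>\<close> being \<open>\<mu> \<sigma>\<close>; for operations on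
  an algebra, \<open>(\<mu> \<sigma>)(a\<^sub>0, \<dots>, a\<^sub>n\<^sub>-\<^sub>1)\<close> is \<open>\<mu>\<close> applied to the list whose entry at
  \<open>i\<close> is the entry of \<open>a\<close> at \<open>\<sigma>\<^sup>-\<^sup>1 i\<close>.
\<close>

record ('r, 'o) operad_data =
  op_scale :: "'r \<Rightarrow> 'o \<Rightarrow> 'o"
  ops :: "nat \<Rightarrow> 'o set"
  op_act :: "nat \<Rightarrow> (nat \<Rightarrow> nat) \<Rightarrow> 'o \<Rightarrow> 'o"
  op_unit :: 'o
  op_comp :: "nat list \<Rightarrow> 'o \<Rightarrow> 'o list \<Rightarrow> 'o"

text \<open>
  \<open>blocks [n\<^sub>1, \<dots>, n\<^sub>k]\<close> cuts the positions \<open>0, \<dots>, n\<^sub>1 + \<dots> + n\<^sub>k - 1\<close> into consecutive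
  blocks of lengths \<open>n\<^sub>1, \<dots>, n\<^sub>k\<close>; \<open>perm_of_list\<close> turns a list of values into a permutation.
  Together they express the two permutations occurring in the equivariance axioms: the block
  permutation in \<open>(\<mu> \<sigma>)(\<nu>\<^sub>\<sigma>\<^sub>0, \<dots>) = \<mu>(\<nu>\<^sub>0, \<dots>) \<rho>\<close> and the direct sum of the \<open>\<tau>\<^sub>i\<close> in
  \<open>\<mu>(\<nu>\<^sub>0 \<tau>\<^sub>0, \<dots>) = \<mu>(\<nu>\<^sub>0, \<dots>) (\<tau>\<^sub>0 \<oplus> \<dots>)\<close>.
\<close>

definition blocks :: "nat list \<Rightarrow> nat list list" where
  "blocks ns = map (\<lambda>i. [sum_list (take i ns) ..< sum_list (take (Suc i) ns)]) [0..<length ns]"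

definition perm_of_list :: "nat list \<Rightarrow> nat \<Rightarrow> nat" where
  "perm_of_list l j = (if j < length l then l ! j else j)"

definition block_perm :: "(nat \<Rightarrow> nat) \<Rightarrow> nat list \<Rightarrow> nat \<Rightarrow> nat" where
  "block_perm \<sigma> ns = perm_of_list (concat (permute_list \<sigma> (blocks ns)))"

definition sum_perm :: "(nat \<Rightarrow> nat) list \<Rightarrow> nat list \<Rightarrow> nat \<Rightarrow> nat" where
  "sum_perm \<tau>s ns = perm_of_list (concat (map2 permute_list \<tau>s (blocks ns)))"

abbreviation ops_list :: "('r, 'o) operad_data \<Rightarrow> nat list \<Rightarrow> 'o list \<Rightarrow> bool" where
  "ops_list P ns \<nu>s \<equiv> list_all2 (\<lambda>n \<nu>. \<nu> \<in> ops P n) ns \<nu>s"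

locale symm_operad =
  fixes P :: "('r::comm_ring_1, 'o::ab_group_add) operad_data"
  assumes module: "module (op_scale P)"
    and ops_submodule: "module.subspace (op_scale P) (ops P n)"
    and act_closed: "\<sigma> permutes {..<n} \<Longrightarrow> \<mu> \<in> ops P n \<Longrightarrow> op_act P n \<sigma> \<mu> \<in> ops P n"
    and act_add: "\<sigma> permutes {..<n} \<Longrightarrow> \<mu> \<in> ops P n \<Longrightarrow> \<nu> \<in> ops P n \<Longrightarrow>
      op_act P n \<sigma> (\<mu> + \<nu>) = op_act P n \<sigma> \<mu> + op_act P n \<sigma> \<nu>"
    and act_scale: "\<sigma> permutes {..<n} \<Longrightarrow> \<mu> \<in> ops P n \<Longrightarrow>
      op_act P n \<sigma> (op_scale P r \<mu>) = op_scale P r (op_act P n \<sigma> \<mu>)"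
    and act_id: "\<mu> \<in> ops P n \<Longrightarrow> op_act P n id \<mu> = \<mu>"
    and act_comp: "\<sigma> permutes {..<n} \<Longrightarrow> \<tau> permutes {..<n} \<Longrightarrow> \<mu> \<in> ops P n \<Longrightarrow>
      op_act P n (\<sigma> \<circ> \<tau>) \<mu> = op_act P n \<tau> (op_act P n \<sigma> \<mu>)"
    and unit_closed: "op_unit P \<in> ops P 1"
    and comp_closed: "\<mu> \<in> ops P (length ns) \<Longrightarrow> ops_list P ns \<nu>s \<Longrightarrow>
      op_comp P ns \<mu> \<nu>s \<in> ops P (sum_list ns)"
    and comp_add_left: "\<mu> \<in> ops P (length ns) \<Longrightarrow> \<mu>' \<in> ops P (length ns) \<Longrightarrow> ops_list P ns \<nu>s \<Longrightarrow>
      op_comp P ns (\<mu> + \<mu>') \<nu>s = op_comp P ns \<mu> \<nu>s + op_comp P ns \<mu>' \<nu>s"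
    and comp_scale_left: "\<mu> \<in> ops P (length ns) \<Longrightarrow> ops_list P ns \<nu>s \<Longrightarrow>
      op_comp P ns (op_scale P r \<mu>) \<nu>s = op_scale P r (op_comp P ns \<mu> \<nu>s)"
    and comp_add_right: "\<mu> \<in> ops P (length ns) \<Longrightarrow> ops_list P ns \<nu>s \<Longrightarrow> i < length ns \<Longrightarrow>
      \<nu> \<in> ops P (ns ! i) \<Longrightarrow> \<nu>' \<in> ops P (ns ! i) \<Longrightarrow>
      op_comp P ns \<mu> (\<nu>s[i := \<nu> + \<nu>']) = op_comp P ns \<mu> (\<nu>s[i := \<nu>]) + op_comp P ns \<mu> (\<nu>s[i := \<nu>'])"
    and comp_scale_right: "\<mu> \<in> ops P (length ns) \<Longrightarrow> ops_list P ns \<nu>s \<Longrightarrow> i < length ns \<Longrightarrow>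
      \<nu> \<in> ops P (ns ! i) \<Longrightarrow>
      op_comp P ns \<mu> (\<nu>s[i := op_scale P r \<nu>]) = op_scale P r (op_comp P ns \<mu> (\<nu>s[i := \<nu>]))"
    and unit_left: "\<nu> \<in> ops P n \<Longrightarrow> op_comp P [n] (op_unit P) [\<nu>] = \<nu>"
    and unit_right: "\<mu> \<in> ops P n \<Longrightarrow> op_comp P (replicate n 1) \<mu> (replicate n (op_unit P)) = \<mu>"
    and assoc: "\<mu> \<in> ops P (length mss) \<Longrightarrow> ops_list P (map length mss) \<nu>s \<Longrightarrow>
      list_all2 (ops_list P) mss \<xi>ss \<Longrightarrow>
      op_comp P (concat mss) (op_comp P (map length mss) \<mu> \<nu>s) (concat \<xi>ss) =
      op_comp P (map sum_list mss) \<mu>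
        (map (\<lambda>i. op_comp P (mss ! i) (\<nu>s ! i) (\<xi>ss ! i)) [0..<length mss])"
    and equivariance_left: "\<mu> \<in> ops P (length ns) \<Longrightarrow> ops_list P ns \<nu>s \<Longrightarrow>
      \<sigma> permutes {..<length ns} \<Longrightarrow>
      op_comp P (permute_list \<sigma> ns) (op_act P (length ns) \<sigma> \<mu>) (permute_list \<sigma> \<nu>s) =
      op_act P (sum_list ns) (block_perm \<sigma> ns) (op_comp P ns \<mu> \<nu>s)"
    and equivariance_right: "\<mu> \<in> ops P (length ns) \<Longrightarrow> ops_list P ns \<nu>s \<Longrightarrow>
      list_all2 (\<lambda>n \<tau>. \<tau> permutes {..<n}) ns \<tau>s \<Longrightarrow>
      op_comp P ns \<mu> (map (\<lambda>i. op_act P (ns ! i) (\<tau>s ! i) (\<nu>s ! i)) [0..<length ns]) =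
      op_act P (sum_list ns) (sum_perm \<tau>s ns) (op_comp P ns \<mu> \<nu>s)"

locale operad_hom =
  fixes P :: "('r::comm_ring_1, 'o::ab_group_add) operad_data"
    and Q :: "('r, 'q::ab_group_add) operad_data"
    and \<phi> :: "nat \<Rightarrow> 'o \<Rightarrow> 'q"
  assumes hom_closed: "\<mu> \<in> ops P n \<Longrightarrow> \<phi> n \<mu> \<in> ops Q n"
    and hom_add: "\<mu> \<in> ops P n \<Longrightarrow> \<nu> \<in> ops P n \<Longrightarrow> \<phi> n (\<mu> + \<nu>) = \<phi> n \<mu> + \<phi> n \<nu>"
    and hom_scale: "\<mu> \<in> ops P n \<Longrightarrow> \<phi> n (op_scale P r \<mu>) = op_scale Q r (\<phi> n \<mu>)"
    and hom_act: "\<sigma> permutes {..<n} \<Longrightarrow> \<mu> \<in> ops P n \<Longrightarrow>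
      \<phi> n (op_act P n \<sigma> \<mu>) = op_act Q n \<sigma> (\<phi> n \<mu>)"
    and hom_unit: "\<phi> 1 (op_unit P) = op_unit Q"
    and hom_comp: "\<mu> \<in> ops P (length ns) \<Longrightarrow> ops_list P ns \<nu>s \<Longrightarrow>
      \<phi> (sum_list ns) (op_comp P ns \<mu> \<nu>s) = op_comp Q ns (\<phi> (length ns) \<mu>) (map2 \<phi> ns \<nu>s)"


section \<open>Free modules on a set\<close>

text \<open>The free module on a set \<open>S\<close> is \<open>{f. Poly_Mapping.keys f \<subseteq> S}\<close>, with this scaling.\<close>

definition free_scale :: "'r::comm_ring_1 \<Rightarrow> ('x \<Rightarrow>\<^sub>0 'r) \<Rightarrow> ('x \<Rightarrow>\<^sub>0 'r)" where
  "free_scale r = Poly_Mapping.map ((*) r)"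

lemma lookup_free_scale: "Poly_Mapping.lookup (free_scale r f) x = r * Poly_Mapping.lookup f x"
  by (simp add: free_scale_def Poly_Mapping.map.rep_eq when_def)

lemma module_free_scale: "module free_scale"
  by unfold_locales (auto intro!: poly_mapping_eqI simp: lookup_free_scale lookup_add algebra_simps)


section \<open>Binary operads\<close>

text \<open>
  The free operad on a set of binary generators without symmetry: in arity \<open>n\<close> it has the basis of
  planar binary trees whose internal vertices are labelled by generators and whose \<open>n\<close> leaves are
  labelled bijectively by the input positions \<open>0, \<dots>, n - 1\<close>.
\<close>

datatype (tree_gens: 'b, tree_leaves: 'l) gtree =
  Leaf 'l
| Node 'b "('b, 'l) gtree" "('b, 'l) gtree"
for map: map_gtree

primrec leaf_list :: "('b, 'l) gtree \<Rightarrow> 'l list" where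
  "leaf_list (Leaf i) = [i]"
| "leaf_list (Node b s t) = leaf_list s @ leaf_list t"

primrec subst_leaves :: "('l \<Rightarrow> ('b, 'm) gtree) \<Rightarrow> ('b, 'l) gtree \<Rightarrow> ('b, 'm) gtree" where
  "subst_leaves f (Leaf i) = f i"
| "subst_leaves f (Node b s t) = Node b (subst_leaves f s) (subst_leaves f t)"

definition relabel :: "('l \<Rightarrow> 'm) \<Rightarrow> ('b, 'l) gtree \<Rightarrow> ('b, 'm) gtree" where
  "relabel f = map_gtree id f"

definition op_trees :: "'b set \<Rightarrow> nat \<Rightarrow> ('b, nat) gtree set" where
  "op_trees B n = {t. tree_gens t \<subseteq> B \<and> distinct (leaf_list t) \<and> set (leaf_list t) = {..<n}}"

definition graft ::
  "nat list \<Rightarrow> ('b, nat) gtree \<Rightarrow> ('b, nat) gtree list \<Rightarrow> ('b, nat) gtree" where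
  "graft ns t ss = subst_leaves (\<lambda>i. relabel (\<lambda>j. sum_list (take i ns) + j) (ss ! i)) t"

text \<open>
  If leaf \<open>i\<close> of \<open>t\<close> stands for the \<open>i\<close>-th input, then in \<open>t \<sigma>\<close> it stands for the input with
  number \<open>\<sigma>\<^sup>-\<^sup>1 i\<close>; this is where the inverse comes from. Composition is the multilinear extension
  of grafting.
\<close>

definition free_binary_operad ::
  "'b set \<Rightarrow> ('r::comm_ring_1, ('b, nat) gtree \<Rightarrow>\<^sub>0 'r) operad_data" where
  "free_binary_operad B = \<lparr>
     op_scale = free_scale,
     ops = (\<lambda>n. {f. Poly_Mapping.keys f \<subseteq> op_trees B n}),
     op_act = (\<lambda>n \<sigma> f. \<Sum>t\<in>Poly_Mapping.keys f.
       Poly_Mapping.single (relabel (inv \<sigma>) t) (Poly_Mapping.lookup f t)),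
     op_unit = Poly_Mapping.single (Leaf 0) 1,
     op_comp = (\<lambda>ns f gs. \<Sum>t\<in>Poly_Mapping.keys f. \<Sum>ss\<in>listset (map Poly_Mapping.keys gs).
       Poly_Mapping.single (graft ns t ss)
         (Poly_Mapping.lookup f t * prod_list (map2 Poly_Mapping.lookup gs ss))) \<rparr>"

definition binary_operad ::
  "'b set \<Rightarrow> ('r::comm_ring_1, 'o::ab_group_add) operad_data \<Rightarrow> bool" where
  "binary_operad B P \<longleftrightarrow> symm_operad P \<and>
     (\<exists>\<phi>. operad_hom (free_binary_operad B) P \<phi> \<and>
          (\<forall>n. \<phi> n ` ops (free_binary_operad B :: ('r, ('b, nat) gtree \<Rightarrow>\<^sub>0 'r) operad_data) n
               = ops P n))"


section \<open>The free algebra on a module\<close>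

text \<open>
  The module \<open>\<Oplus>\<^sub>n P(n) \<otimes>\<^bsub>S\<^sub>n\<^esub> V\<^sup>\<otimes>\<^sup>n\<close> is constructed by generators and
  relations. The generators are the formal symbols \<open>\<mu> \<otimes> v\<^sub>1 \<otimes> \<dots> \<otimes> v\<^sub>n\<close>, encoded as pairs
  \<open>(\<mu>, vs)\<close>; the length of \<open>vs\<close> is the arity \<open>n\<close>. All the relations are homogeneous in \<open>n\<close>, so
  that the quotient is the direct sum of the tensor products. The elements of the free algebra
  are cosets of the submodule of relations.
\<close>

type_synonym ('r, 'o, 'v) formal = "('o \<times> 'v list) \<Rightarrow>\<^sub>0 'r"

definition sym_tensors :: "('r, 'o) operad_data \<Rightarrow> nat \<Rightarrow> ('o \<times> 'v list) set" where
  "sym_tensors P n = {(\<mu>, vs). length vs = n \<and> \<mu> \<in> ops P n}"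

inductive_set tensor_rels ::
  "('r::comm_ring_1, 'o::ab_group_add) operad_data \<Rightarrow> ('r \<Rightarrow> 'v::ab_group_add \<Rightarrow> 'v) \<Rightarrow>
   ('r, 'o, 'v) formal set"
  for P :: "('r::comm_ring_1, 'o::ab_group_add) operad_data"
    and sV :: "'r \<Rightarrow> 'v::ab_group_add \<Rightarrow> 'v"
where
  op_add: "\<mu> \<in> ops P (length vs) \<Longrightarrow> \<nu> \<in> ops P (length vs) \<Longrightarrow>
    Poly_Mapping.single (\<mu> + \<nu>, vs) 1 - (Poly_Mapping.single (\<mu>, vs) 1 + Poly_Mapping.single (\<nu>, vs) 1)
    \<in> tensor_rels P sV"
| op_scale: "\<mu> \<in> ops P (length vs) \<Longrightarrow>
    Poly_Mapping.single (op_scale P r \<mu>, vs) 1 - Poly_Mapping.single (\<mu>, vs) r \<in> tensor_rels P sV"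
| arg_add: "\<mu> \<in> ops P (length vs) \<Longrightarrow> i < length vs \<Longrightarrow>
    Poly_Mapping.single (\<mu>, vs[i := v + w]) 1 -
      (Poly_Mapping.single (\<mu>, vs[i := v]) 1 + Poly_Mapping.single (\<mu>, vs[i := w]) 1)
    \<in> tensor_rels P sV"
| arg_scale: "\<mu> \<in> ops P (length vs) \<Longrightarrow> i < length vs \<Longrightarrow>
    Poly_Mapping.single (\<mu>, vs[i := sV r v]) 1 - Poly_Mapping.single (\<mu>, vs[i := v]) r
    \<in> tensor_rels P sV"
| symm: "\<mu> \<in> ops P (length vs) \<Longrightarrow> \<sigma> permutes {..<length vs} \<Longrightarrow>
    Poly_Mapping.single (op_act P (length vs) \<sigma> \<mu>, permute_list \<sigma> vs) 1 -
      Poly_Mapping.single (\<mu>, vs) 1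
    \<in> tensor_rels P sV"

definition relmod ::
  "('r::comm_ring_1, 'o::ab_group_add) operad_data \<Rightarrow> ('r \<Rightarrow> 'v::ab_group_add \<Rightarrow> 'v) \<Rightarrow>
   ('r, 'o, 'v) formal set" where
  "relmod P sV = module.span free_scale (tensor_rels P sV)"

definition coset ::
  "('r::comm_ring_1, 'o::ab_group_add) operad_data \<Rightarrow> ('r \<Rightarrow> 'v::ab_group_add \<Rightarrow> 'v) \<Rightarrow>
   ('r, 'o, 'v) formal \<Rightarrow> ('r, 'o, 'v) formal set" where
  "coset P sV f = {g. g - f \<in> relmod P sV}"

definition fa_carrier ::
  "('r::comm_ring_1, 'o::ab_group_add) operad_data \<Rightarrow> ('r \<Rightarrow> 'v::ab_group_add \<Rightarrow> 'v) \<Rightarrow>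
   ('r, 'o, 'v) formal set set" where
  "fa_carrier P sV = coset P sV ` {f. Poly_Mapping.keys f \<subseteq> (\<Union>n. sym_tensors P n)}"

definition fa_graded ::
  "('r::comm_ring_1, 'o::ab_group_add) operad_data \<Rightarrow> ('r \<Rightarrow> 'v::ab_group_add \<Rightarrow> 'v) \<Rightarrow> nat \<Rightarrow>
   ('r, 'o, 'v) formal set set" where
  "fa_graded P sV n = coset P sV ` {f. Poly_Mapping.keys f \<subseteq> sym_tensors P n}"

definition fa_zero ::
  "('r::comm_ring_1, 'o::ab_group_add) operad_data \<Rightarrow> ('r \<Rightarrow> 'v::ab_group_add \<Rightarrow> 'v) \<Rightarrow>
   ('r, 'o, 'v) formal set" where
  "fa_zero P sV = coset P sV 0"

text \<open>As usual for quotients, the union in the following operations is one over equal cosets.\<close>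

definition fa_add ::
  "('r::comm_ring_1, 'o::ab_group_add) operad_data \<Rightarrow> ('r \<Rightarrow> 'v::ab_group_add \<Rightarrow> 'v) \<Rightarrow>
   ('r, 'o, 'v) formal set \<Rightarrow> ('r, 'o, 'v) formal set \<Rightarrow> ('r, 'o, 'v) formal set" where
  "fa_add P sV X Y = (\<Union>x\<in>X. \<Union>y\<in>Y. coset P sV (x + y))"

definition fa_scale ::
  "('r::comm_ring_1, 'o::ab_group_add) operad_data \<Rightarrow> ('r \<Rightarrow> 'v::ab_group_add \<Rightarrow> 'v) \<Rightarrow>
   'r \<Rightarrow> ('r, 'o, 'v) formal set \<Rightarrow> ('r, 'o, 'v) formal set" where
  "fa_scale P sV r X = (\<Union>x\<in>X. coset P sV (free_scale r x))"

definition fa_sum ::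
  "('r::comm_ring_1, 'o::ab_group_add) operad_data \<Rightarrow> ('r \<Rightarrow> 'v::ab_group_add \<Rightarrow> 'v) \<Rightarrow>
   ('r, 'o, 'v) formal set list \<Rightarrow> ('r, 'o, 'v) formal set" where
  "fa_sum P sV Xs = foldr (fa_add P sV) Xs (fa_zero P sV)"

text \<open>
  The algebra structure is the multilinear extension of
  \<open>\<mu>(\<nu>\<^sub>1 \<otimes> vs\<^sub>1, \<dots>, \<nu>\<^sub>k \<otimes> vs\<^sub>k) = \<mu>(\<nu>\<^sub>1, \<dots>, \<nu>\<^sub>k) \<otimes> vs\<^sub>1 \<otimes> \<dots> \<otimes> vs\<^sub>k\<close>,
  first on formal combinations and then on cosets.
\<close>

definition formal_op ::
  "('r::comm_ring_1, 'o::ab_group_add) operad_data \<Rightarrow> 'o \<Rightarrow> ('r, 'o, 'v) formal list \<Rightarrow>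
   ('r, 'o, 'v) formal" where
  "formal_op P \<mu> fs = (\<Sum>xs\<in>listset (map Poly_Mapping.keys fs).
     Poly_Mapping.single
       (op_comp P (map (length \<circ> snd) xs) \<mu> (map fst xs), concat (map snd xs))
       (prod_list (map2 Poly_Mapping.lookup fs xs)))"

definition fa_op ::
  "('r::comm_ring_1, 'o::ab_group_add) operad_data \<Rightarrow> ('r \<Rightarrow> 'v::ab_group_add \<Rightarrow> 'v) \<Rightarrow>
   'o \<Rightarrow> ('r, 'o, 'v) formal set list \<Rightarrow> ('r, 'o, 'v) formal set" where
  "fa_op P sV \<mu> Xs = (\<Union>fs\<in>listset Xs. coset P sV (formal_op P \<mu> fs))"

definition fa_incl ::
  "('r::comm_ring_1, 'o::ab_group_add) operad_data \<Rightarrow> ('r \<Rightarrow> 'v::ab_group_add \<Rightarrow> 'v) \<Rightarrow>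
   'v \<Rightarrow> ('r, 'o, 'v) formal set" where
  "fa_incl P sV v = coset P sV (Poly_Mapping.single (op_unit P, [v]) 1)"


section \<open>Derivations and the preLie product\<close>

type_synonym ('r, 'o, 'v) fa_map = "('r, 'o, 'v) formal set \<Rightarrow> ('r, 'o, 'v) formal set"

text \<open>Maps on the free algebra are made extensional, so that equal derivations are equal functions.\<close>

definition Der ::
  "('r::comm_ring_1, 'o::ab_group_add) operad_data \<Rightarrow> ('r \<Rightarrow> 'v::ab_group_add \<Rightarrow> 'v) \<Rightarrow>
   ('r, 'o, 'v) fa_map set" where
  "Der P sV = {d \<in> fa_carrier P sV \<rightarrow>\<^sub>E fa_carrier P sV.
     (\<forall>x\<in>fa_carrier P sV. \<forall>y\<in>fa_carrier P sV. d (fa_add P sV x y) = fa_add P sV (d x) (d y)) \<and>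
     (\<forall>r. \<forall>x\<in>fa_carrier P sV. d (fa_scale P sV r x) = fa_scale P sV r (d x)) \<and>
     (\<forall>as\<in>lists (fa_carrier P sV). \<forall>\<mu>\<in>ops P (length as).
        d (fa_op P sV \<mu> as) =
        fa_sum P sV (map (\<lambda>i. fa_op P sV \<mu> (as[i := d (as ! i)])) [0..<length as]))}"

definition der_zero ::
  "('r::comm_ring_1, 'o::ab_group_add) operad_data \<Rightarrow> ('r \<Rightarrow> 'v::ab_group_add \<Rightarrow> 'v) \<Rightarrow>
   ('r, 'o, 'v) fa_map" where
  "der_zero P sV = (\<lambda>x\<in>fa_carrier P sV. fa_zero P sV)"

definition der_add ::
  "('r::comm_ring_1, 'o::ab_group_add) operad_data \<Rightarrow> ('r \<Rightarrow> 'v::ab_group_add \<Rightarrow> 'v) \<Rightarrow>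
   ('r, 'o, 'v) fa_map \<Rightarrow> ('r, 'o, 'v) fa_map \<Rightarrow> ('r, 'o, 'v) fa_map" where
  "der_add P sV d e = (\<lambda>x\<in>fa_carrier P sV. fa_add P sV (d x) (e x))"

definition der_scale ::
  "('r::comm_ring_1, 'o::ab_group_add) operad_data \<Rightarrow> ('r \<Rightarrow> 'v::ab_group_add \<Rightarrow> 'v) \<Rightarrow>
   'r \<Rightarrow> ('r, 'o, 'v) fa_map \<Rightarrow> ('r, 'o, 'v) fa_map" where
  "der_scale P sV r d = (\<lambda>x\<in>fa_carrier P sV. fa_scale P sV r (d x))"

definition der_prelie ::
  "('r::comm_ring_1, 'o::ab_group_add) operad_data \<Rightarrow> ('r \<Rightarrow> 'v::ab_group_add \<Rightarrow> 'v) \<Rightarrow>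
   ('r, 'o, 'v) fa_map \<Rightarrow> ('r, 'o, 'v) fa_map \<Rightarrow> ('r, 'o, 'v) fa_map" where
  "der_prelie P sV d e =
     (THE c. c \<in> Der P sV \<and> (\<forall>v. c (fa_incl P sV v) = e (d (fa_incl P sV v))))"

definition der_submodule ::
  "('r::comm_ring_1, 'o::ab_group_add) operad_data \<Rightarrow> ('r \<Rightarrow> 'v::ab_group_add \<Rightarrow> 'v) \<Rightarrow>
   ('r, 'o, 'v) fa_map set \<Rightarrow> bool" where
  "der_submodule P sV L \<longleftrightarrow> L \<subseteq> Der P sV \<and> der_zero P sV \<in> L \<and>
     (\<forall>d\<in>L. \<forall>e\<in>L. der_add P sV d e \<in> L) \<and> (\<forall>r. \<forall>d\<in>L. der_scale P sV r d \<in> L)"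

definition sub_prelie ::
  "('r::comm_ring_1, 'o::ab_group_add) operad_data \<Rightarrow> ('r \<Rightarrow> 'v::ab_group_add \<Rightarrow> 'v) \<Rightarrow>
   ('r, 'o, 'v) fa_map set \<Rightarrow> bool" where
  "sub_prelie P sV L \<longleftrightarrow> der_submodule P sV L \<and> (\<forall>d\<in>L. \<forall>e\<in>L. der_prelie P sV d e \<in> L)"

definition Der_deg ::
  "('r::comm_ring_1, 'o::ab_group_add) operad_data \<Rightarrow> ('r \<Rightarrow> 'v::ab_group_add \<Rightarrow> 'v) \<Rightarrow> nat \<Rightarrow>
   ('r, 'o, 'v) fa_map set" where
  "Der_deg P sV k = {d \<in> Der P sV. \<forall>v. d (fa_incl P sV v) \<in> fa_graded P sV (k + 1)}"

definition Der_plus ::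
  "('r::comm_ring_1, 'o::ab_group_add) operad_data \<Rightarrow> ('r \<Rightarrow> 'v::ab_group_add \<Rightarrow> 'v) \<Rightarrow>
   ('r, 'o, 'v) fa_map set" where
  "Der_plus P sV = \<Inter>{L. der_submodule P sV L \<and> (\<Union>k\<in>{1..}. Der_deg P sV k) \<subseteq> L}"

definition Der_preLie1 ::
  "('r::comm_ring_1, 'o::ab_group_add) operad_data \<Rightarrow> ('r \<Rightarrow> 'v::ab_group_add \<Rightarrow> 'v) \<Rightarrow>
   ('r, 'o, 'v) fa_map set" where
  "Der_preLie1 P sV = \<Inter>{L. sub_prelie P sV L \<and> Der_deg P sV 1 \<subseteq> L}"

definition free_module_of_rank :: "('r::comm_ring_1 \<Rightarrow> 'v::ab_group_add \<Rightarrow> 'v) \<Rightarrow> nat \<Rightarrow> bool" where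
  "free_module_of_rank sV r \<longleftrightarrow> module sV \<and>
     (\<exists>X. finite X \<and> card X = r \<and> \<not> module.dependent sV X \<and> module.span sV X = UNIV)"

end

theory Submission
  imports Defs
begin

text \<open>
  A derivation of the free algebra is determined by its restriction to \<open>V\<close>, which can be any linear
  map (\<open>Der_ext\<close>, \<open>der_of_Der\<close>), and \<open>d \<lhd> e\<close> applies \<open>e\<close> to the values of \<open>d\<close> on \<open>V\<close>. Fix a
  basis \<open>X\<close> of \<open>V\<close> and write \<open>[x \<mapsto> f]\<close> for the derivation that sends \<open>x \<in> X\<close> to \<open>f\<close> and the
  other basis elements to \<open>0\<close>. Every derivation is a finite sum of these, so the theorem says that
  \<open>[x \<mapsto> f]\<close>, for \<open>f\<close> of arity \<open>n \<ge> 2\<close>, lies in each sub preLie algebra \<open>L\<close> that contains the part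
  of degree one. This is proved by induction on \<open>n\<close> in \<open>E_generated\<close>; only \<open>n \<ge> 3\<close> needs an argument.

  Since the operad is binary, \<open>f\<close> is a linear combination of products \<open>\<beta>(f\<^sub>1, f\<^sub>2)\<close> with \<open>\<beta>\<close> of arity
  two and \<open>f\<^sub>1\<close>, \<open>f\<^sub>2\<close> of positive arities \<open>p + q = n\<close> (\<open>graded_decompose\<close>), so let \<open>f\<close> be such a
  product.

  \<^item> If \<open>q = 1\<close>, then \<open>f\<^sub>2\<close> may be taken to be a basis element \<open>z\<close>. As the rank is not one, there is
    a basis element \<open>y \<noteq> z\<close>, and \<open>[x \<mapsto> \<beta>(f\<^sub>1, z)] = [x \<mapsto> \<beta>(y, z)] \<lhd> [y \<mapsto> f\<^sub>1]\<close>. The first factor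
    has degree one and the second is in \<open>L\<close> by induction. For \<open>y = z\<close> the product would have the
    additional term \<open>[x \<mapsto> \<beta>(y, f\<^sub>1)]\<close>. The case \<open>p = 1\<close> is symmetric (\<open>op_\<iota>_in\<close>).

  \<^item> If \<open>p, q \<ge> 2\<close>, then \<open>[x \<mapsto> \<beta>(f\<^sub>1, z)] \<lhd> [z \<mapsto> f\<^sub>2] = [x \<mapsto> \<beta>(f\<^sub>1, f\<^sub>2)] + [x \<mapsto> \<beta>(D f\<^sub>1, z)]\<close> for
    any basis element \<open>z\<close>, where \<open>D\<close> is the derivation \<open>[z \<mapsto> f\<^sub>2]\<close>. Both factors are in \<open>L\<close> by what
    precedes, and so is the last term, because \<open>D f\<^sub>1\<close> has arity \<open>n - 1\<close>.

  For the inclusion in the other direction, the derivations with values of arity at least two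
  form a sub preLie algebra (\<open>sub_prelie_positive\<close>).

  The free algebra is a quotient, but the calculations take place before passing to it. On formal
  combinations the operations are strictly multilinear and strictly associative
  (\<open>formal_op_assoc\<close>), hence a linear map from \<open>V\<close> to formal combinations extends by the Leibniz
  rule to a map that is strictly a derivation (\<open>der_formal_op\<close>). What holds only modulo the relations
  is linearity in the operation, linearity in \<open>V\<close> and equivariance; this suffices to see
  that operations and derivations descend to the quotient (\<open>formal_op_cong\<close>, \<open>der_formal_relmod\<close>).
\<close>

section \<open>Linear and multilinear extension\<close>

interpretation free: module "free_scale :: 'r::comm_ring_1 \<Rightarrow> ('x \<Rightarrow>\<^sub>0 'r) \<Rightarrow> ('x \<Rightarrow>\<^sub>0 'r)"
  by (rule module_free_scale)

abbreviation sg :: "'x \<Rightarrow> ('x \<Rightarrow>\<^sub>0 'r::comm_ring_1)" where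
  "sg x \<equiv> Poly_Mapping.single x 1"

lemma free_scale_single [simp]:
  "free_scale r (Poly_Mapping.single x c) = Poly_Mapping.single x (r * c)"
  by (rule poly_mapping_eqI) (simp add: lookup_free_scale lookup_single when_def)

lemma keys_free_scale: "Poly_Mapping.keys (free_scale r f) \<subseteq> Poly_Mapping.keys f"
  by (auto simp: in_keys_iff lookup_free_scale)

lemma subspace_keys: "free.subspace {f. Poly_Mapping.keys f \<subseteq> S}"
  unfolding free.subspace_def
  by (auto dest!: subsetD[OF Poly_Mapping.keys_add] subsetD[OF keys_free_scale])

definition lin :: "('x \<Rightarrow> ('y \<Rightarrow>\<^sub>0 'r::comm_ring_1)) \<Rightarrow> ('x \<Rightarrow>\<^sub>0 'r) \<Rightarrow> ('y \<Rightarrow>\<^sub>0 'r)" where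
  "lin h f = (\<Sum>x\<in>Poly_Mapping.keys f. free_scale (Poly_Mapping.lookup f x) (h x))"

lemma lin_superset:
  assumes "finite S" "Poly_Mapping.keys f \<subseteq> S"
  shows "lin h f = (\<Sum>x\<in>S. free_scale (Poly_Mapping.lookup f x) (h x))"
  unfolding lin_def using assms
  by (intro sum.mono_neutral_left) (auto simp: in_keys_iff)

lemma lin_zero [simp]: "lin h 0 = 0"
  by (simp add: lin_def)

lemma lin_single [simp]: "lin h (Poly_Mapping.single x c) = free_scale c (h x)"
  by (subst lin_superset[of "{x}"]) auto

lemma lin_add: "lin h (f + g) = lin h f + lin h g"
proof -
  let ?S = "Poly_Mapping.keys f \<union> Poly_Mapping.keys g"
  have "Poly_Mapping.keys (f + g) \<subseteq> ?S" by (rule Poly_Mapping.keys_add)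
  then show ?thesis
    by (simp add: lin_superset[of ?S] lookup_add free.scale_left_distrib sum.distrib)
qed

lemma lin_scale: "lin h (free_scale c f) = free_scale c (lin h f)"
  using keys_free_scale[of c f]
  by (simp add: lin_superset[of "Poly_Mapping.keys f"] lookup_free_scale free.scale_sum_right)

lemma lin_diff: "lin h (f - g) = lin h f - lin h g"
  using lin_add[of h "f - g" g] by (simp add: algebra_simps)

lemma lin_sum: "lin h (sum f A) = (\<Sum>i\<in>A. lin h (f i))"
  by (induction A rule: infinite_finite_induct) (auto simp: lin_add)

lemma lin_add_fun: "lin (\<lambda>x. h x + k x) f = lin h f + lin k f"
  by (simp add: lin_def free.scale_right_distrib sum.distrib)

lemma lin_scale_fun: "lin (\<lambda>x. free_scale c (h x)) f = free_scale c (lin h f)"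
  by (simp add: lin_def free.scale_sum_right mult.commute)

lemma lin_zero_fun [simp]: "lin (\<lambda>x. 0) f = 0"
  by (simp add: lin_def)

lemma lin_diff_fun: "lin (\<lambda>x. h x - k x) f = lin h f - lin k f"
  by (simp add: lin_def free.scale_right_diff_distrib sum_subtractf)

lemma lin_cong: "(\<And>x. x \<in> Poly_Mapping.keys f \<Longrightarrow> h x = k x) \<Longrightarrow> lin h f = lin k f"
  by (simp add: lin_def)

lemma lin_in_subspace:
  assumes "free.subspace S" "\<And>x. x \<in> Poly_Mapping.keys f \<Longrightarrow> h x \<in> S"
  shows "lin h f \<in> S"
  unfolding lin_def using assms by (auto intro!: free.subspace_sum free.subspace_scale)

lemma lin_sg [simp]: "lin sg f = f"
  by (rule poly_mapping_eqI)
     (simp add: lin_def lookup_sum lookup_single when_def in_keys_iff)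

lemma free_subspace_induct:
  assumes "free.subspace S" "\<And>x. x \<in> Poly_Mapping.keys f \<Longrightarrow> sg x \<in> S"
  shows "f \<in> S"
  using lin_in_subspace[of S f sg] assms by simp

lemma subspace_lin_vimage: "free.subspace S \<Longrightarrow> free.subspace {f. lin h f \<in> S}"
  by (simp add: free.subspace_def lin_add lin_scale)

lemma lin_lin: "lin h (lin k f) = lin (\<lambda>x. lin h (k x)) f"
  by (simp add: lin_def[of k] lin_def[of "\<lambda>x. lin h (k x)"] lin_sum lin_scale)

lemma lin_swap: "lin (\<lambda>x. lin (h x) g) f = lin (\<lambda>y. lin (\<lambda>x. h x y) f) g"
  unfolding lin_def free.scale_sum_right
  by (subst sum.swap) (simp add: mult.commute)

text \<open>
  The multilinear extension of \<open>h\<close>. The recursion extends one argument at a time, so that statements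
  about several arguments reduce by induction to statements about \<open>lin\<close>; the closed form, which the
  operations on formal combinations are given by, is \<open>mlin_eq_sum\<close>.
\<close>

primrec mlin ::
  "('x \<Rightarrow>\<^sub>0 'r::comm_ring_1) list \<Rightarrow> ('x list \<Rightarrow> ('y \<Rightarrow>\<^sub>0 'r)) \<Rightarrow> ('y \<Rightarrow>\<^sub>0 'r)" where
  "mlin [] h = h []"
| "mlin (f # fs) h = lin (\<lambda>x. mlin fs (\<lambda>xs. h (x # xs))) f"

lemma mlin_eq_sum:
  "mlin fs h = (\<Sum>xs\<in>listset (map Poly_Mapping.keys fs).
     free_scale (prod_list (map2 Poly_Mapping.lookup fs xs)) (h xs))"
proof (induction fs arbitrary: h)
  case (Cons f fs)
  have eq: "listset (map Poly_Mapping.keys (f # fs)) =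
      (\<lambda>(x, xs). x # xs) ` (Poly_Mapping.keys f \<times> listset (map Poly_Mapping.keys fs))"
    by (auto simp: set_Cons_def)
  show ?case
    unfolding eq
    by (subst sum.reindex)
       (simp_all add: inj_on_def Cons lin_def free.scale_sum_right sum.cartesian_product
          comp_def split_def)
qed simp

lemma mlin_cong:
  "(\<And>xs. list_all2 (\<lambda>x f. x \<in> Poly_Mapping.keys f) xs fs \<Longrightarrow> h xs = k xs) \<Longrightarrow> mlin fs h = mlin fs k"
proof (induction fs arbitrary: h k)
  case (Cons f fs)
  have "mlin fs (\<lambda>xs. h (x # xs)) = mlin fs (\<lambda>xs. k (x # xs))" if "x \<in> Poly_Mapping.keys f" for x
    by (rule Cons.IH) (simp add: Cons.prems that)
  then show ?case by (simp cong: lin_cong)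
qed simp

lemma mlin_in_subspace:
  assumes "free.subspace S"
    and "\<And>xs. list_all2 (\<lambda>x f. x \<in> Poly_Mapping.keys f) xs fs \<Longrightarrow> h xs \<in> S"
  shows "mlin fs h \<in> S"
  using assms(2)
proof (induction fs arbitrary: h)
  case (Cons f fs)
  have "mlin fs (\<lambda>xs. h (x # xs)) \<in> S" if "x \<in> Poly_Mapping.keys f" for x
    by (rule Cons.IH) (simp add: Cons.prems that)
  then show ?case by (simp add: lin_in_subspace[OF assms(1)])
qed simp

lemma mlin_add_fun: "mlin fs (\<lambda>xs. h xs + k xs) = mlin fs h + mlin fs k"
  by (induction fs arbitrary: h k) (auto simp: lin_add_fun)

lemma mlin_scale_fun: "mlin fs (\<lambda>xs. free_scale c (h xs)) = free_scale c (mlin fs h)"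
  by (induction fs arbitrary: h) (auto simp: lin_scale_fun)

lemma mlin_diff_fun: "mlin fs (\<lambda>xs. h xs - k xs) = mlin fs h - mlin fs k"
  by (induction fs arbitrary: h k) (auto simp: lin_diff_fun)

lemma mlin_zero_fun [simp]: "mlin fs (\<lambda>xs. 0) = 0"
  by (induction fs) auto

lemma mlin_sum_fun: "mlin fs (\<lambda>xs. \<Sum>i\<in>A. h i xs) = (\<Sum>i\<in>A. mlin fs (h i))"
  by (induction A rule: infinite_finite_induct) (auto simp: mlin_add_fun)

lemma lin_mlin: "lin k (mlin fs h) = mlin fs (\<lambda>xs. lin k (h xs))"
  by (induction fs arbitrary: h) (auto simp: lin_lin)

lemma mlin_sg [simp]: "mlin (map sg xs) h = h xs"
  by (induction xs arbitrary: h) auto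

lemma mlin_append: "mlin (fs @ gs) h = mlin fs (\<lambda>xs. mlin gs (\<lambda>ys. h (xs @ ys)))"
  by (induction fs arbitrary: h) auto

lemma lin_mlin_swap: "lin (\<lambda>x. mlin fs (h x)) f = mlin fs (\<lambda>xs. lin (\<lambda>x. h x xs) f)"
proof (induction fs arbitrary: h)
  case (Cons g fs)
  show ?case
    by (simp add: lin_swap[where g = g] Cons)
qed simp

text \<open>
  The extension in one chosen argument can be carried out innermost, because linear extensions
  commute. Linearity in that argument is then linearity of \<open>lin\<close>.
\<close>

lemma mlin_slot:
  "mlin (fs @ f # gs) h = mlin fs (\<lambda>xs. mlin gs (\<lambda>ys. lin (\<lambda>x. h (xs @ x # ys)) f))"
  by (simp add: mlin_append lin_mlin_swap)

lemma mlin_update: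
  assumes "i < length fs"
  shows "mlin (fs[i := f]) h =
    mlin (take i fs) (\<lambda>xs. mlin (drop (Suc i) fs) (\<lambda>ys. lin (\<lambda>x. h (xs @ x # ys)) f))"
  using assms by (simp add: upd_conv_take_nth_drop mlin_slot)

lemma mlin_update_add:
  "i < length fs \<Longrightarrow> mlin (fs[i := f + g]) h = mlin (fs[i := f]) h + mlin (fs[i := g]) h"
  by (simp add: mlin_update lin_add mlin_add_fun)

lemma mlin_update_scale:
  "i < length fs \<Longrightarrow> mlin (fs[i := free_scale c f]) h = free_scale c (mlin (fs[i := f]) h)"
  by (simp add: mlin_update lin_scale mlin_scale_fun)

lemma mlin_update_zero: "i < length fs \<Longrightarrow> mlin (fs[i := 0]) h = 0"
  by (simp add: mlin_update)

lemma mlin_update_sum: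
  "i < length fs \<Longrightarrow> mlin (fs[i := sum g A]) h = (\<Sum>j\<in>A. mlin (fs[i := g j]) h)"
  by (simp add: mlin_update lin_sum mlin_sum_fun)

lemma mlin_update_diff:
  "i < length fs \<Longrightarrow> mlin (fs[i := f - g]) h = mlin (fs[i := f]) h - mlin (fs[i := g]) h"
  by (simp add: mlin_update lin_diff mlin_diff_fun)

lemma mlin_sg_update:
  assumes "i < length xs"
  shows "mlin ((map sg xs)[i := f]) h = lin (\<lambda>y. h (xs[i := y])) f"
  using assms by (simp add: upd_conv_take_nth_drop take_map drop_map mlin_slot)

text \<open>
  A linear map inside one argument may be applied to basis elements first. This carries the
  Leibniz rule over from basis elements to arbitrary arguments.
\<close>

lemma mlin_update_lin:
  assumes "i < length fs"
  shows "mlin (fs[i := lin k (fs ! i)]) h =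
    mlin fs (\<lambda>xs. mlin ((map sg xs)[i := k (xs ! i)]) h)"
  using assms
proof (induction fs arbitrary: i h)
  case (Cons f fs)
  show ?case
  proof (cases i)
    case 0
    have "mlin (lin k f # fs) h = lin (\<lambda>x. lin (\<lambda>y. mlin fs (\<lambda>ys. h (y # ys))) (k x)) f"
      by (simp add: lin_lin)
    then show ?thesis using 0 by (simp add: lin_mlin_swap)
  next
    case (Suc j)
    then show ?thesis using Cons by simp
  qed
qed simp

text \<open>
  A multilinear expression in multilinear expressions is again multilinear in all the inner
  arguments together, so that associativity needs to be known on basis elements only.
\<close>

lemma mlin_concat:
  assumes "length us = length fss"
    and "\<And>xss. list_all2 (list_all2 (\<lambda>x f. x \<in> Poly_Mapping.keys f)) xss fss \<Longrightarrow>
      H (concat xss) = h (map2 (\<lambda>u xs. u xs) us xss)"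
  shows "mlin (concat fss) H = mlin (map2 (\<lambda>u fs. mlin fs (\<lambda>xs. sg (u xs))) us fss) h"
  using assms
proof (induction fss arbitrary: us H h)
  case (Cons fs fss)
  then obtain u us' where us: "us = u # us'" by (cases us) auto
  have "mlin (concat fss) (\<lambda>ys. H (xs @ ys)) =
      mlin (map2 (\<lambda>u fs. mlin fs (\<lambda>xs. sg (u xs))) us' fss) (\<lambda>ys. h (u xs # ys))"
    if "list_all2 (\<lambda>x f. x \<in> Poly_Mapping.keys f) xs fs" for xs
  proof (rule Cons.IH)
    show "length us' = length fss" using Cons.prems us by simp
    fix xss assume "list_all2 (list_all2 (\<lambda>x f. x \<in> Poly_Mapping.keys f)) xss fss"
    then show "H (xs @ concat xss) = h (u xs # map2 (\<lambda>u xs. u xs) us' xss)"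
      using Cons.prems(2)[of "xs # xss"] us that by simp
  qed
  then have "mlin fs (\<lambda>xs. mlin (concat fss) (\<lambda>ys. H (xs @ ys))) =
      mlin fs (\<lambda>xs. mlin (map2 (\<lambda>u fs. mlin fs (\<lambda>xs. sg (u xs))) us' fss) (\<lambda>ys. h (u xs # ys)))"
    by (rule mlin_cong)
  then show ?case
    by (simp add: mlin_append us lin_mlin)
qed simp

section \<open>Block permutations\<close>

lemma blocks_snoc: "blocks (ns @ [n]) = blocks ns @ [[sum_list ns ..< sum_list ns + n]]"
  by (auto simp: blocks_def)

lemma length_blocks [simp]: "length (blocks ns) = length ns"
  by (simp add: blocks_def)

lemma concat_blocks: "concat (blocks ns) = [0..<sum_list ns]"
proof (induction ns rule: rev_induct)
  case (snoc n ns)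
  then show ?case using upt_add_eq_append[of 0 "sum_list ns" n] by (simp add: blocks_snoc)
qed (simp add: blocks_def)

lemma length_nth_blocks: "i < length ns \<Longrightarrow> length (blocks ns ! i) = ns ! i"
  by (simp add: blocks_def take_Suc_conv_app_nth)

text \<open>
  The blocks of positions, read as entries of the concatenation, are the original lists. In this
  way a rearrangement of positions turns into a rearrangement of arguments.
\<close>

lemma map_blocks:
  "map (map ((!) (concat vss))) (blocks (map length vss)) = vss"
proof (induction vss rule: rev_induct)
  case (snoc vs vss)
  have "map (map ((!) (concat vss @ vs))) (blocks (map length vss)) =
      map (map ((!) (concat vss))) (blocks (map length vss))"
  proof (intro map_cong refl)
    fix js j assume "js \<in> set (blocks (map length vss))" "j \<in> set js"
    then have "j \<in> set (concat (blocks (map length vss)))" by auto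
    then have "j < length (concat vss)" by (simp add: concat_blocks length_concat)
    then show "(concat vss @ vs) ! j = concat vss ! j" by (simp add: nth_append)
  qed
  moreover have "map ((!) (concat vss @ vs)) [length (concat vss) ..< length (concat vss) + length vs] = vs"
    by (rule nth_equalityI) (auto simp: nth_append)
  ultimately show ?case using snoc by (simp add: blocks_snoc length_concat)
qed (simp add: blocks_def)

lemma perm_of_list_permutes:
  assumes "distinct l" "set l = {..<length l}"
  shows "perm_of_list l permutes {..<length l}"
proof (rule bij_imp_permutes)
  show "bij_betw (perm_of_list l) {..<length l} {..<length l}"
  proof (rule iffD2[OF bij_betw_cong])
    show "bij_betw ((!) l) {..<length l} {..<length l}"
      using bij_betw_nth[of l "{..<length l}" "set l"] assms by simp
  qed (simp add: perm_of_list_def)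
qed (simp add: perm_of_list_def)

lemma permute_perm_of_list:
  "length l = length xs \<Longrightarrow> permute_list (perm_of_list l) xs = map ((!) xs) l"
  unfolding permute_list_def perm_of_list_def by (rule nth_equalityI) auto

lemma mset_perm_of_list:
  assumes "mset l = mset [0..<n]"
  shows "perm_of_list l permutes {..<n}" "length l = n"
proof -
  show l: "length l = n" using mset_eq_length[OF assms] by simp
  show "perm_of_list l permutes {..<n}"
    using perm_of_list_permutes[of l] mset_eq_setD[OF assms] mset_eq_imp_distinct_iff[OF assms] l
    by (auto simp: atLeast0LessThan)
qed

text \<open>
  The permutations in the two equivariance axioms do to the concatenated list of all inputs what
  \<open>\<sigma>\<close> and the \<open>\<tau>\<^sub>i\<close> do to the list of blocks and inside the blocks. With this the axioms match the
  symmetry relation of the tensor product.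
\<close>

context
  fixes \<sigma> :: "nat \<Rightarrow> nat" and vss :: "'a list list"
  assumes \<sigma>: "\<sigma> permutes {..<length vss}"
begin

lemma block_perm_list:
  "mset (concat (permute_list \<sigma> (blocks (map length vss)))) = mset [0..<length (concat vss)]"
proof -
  have "mset (map mset (permute_list \<sigma> (blocks (map length vss)))) = mset (map mset (blocks (map length vss)))"
    using \<sigma> by simp
  then have "mset (concat (permute_list \<sigma> (blocks (map length vss)))) = mset (concat (blocks (map length vss)))"
    by (metis mset_concat sum_mset_sum_list)
  then show ?thesis by (simp add: concat_blocks length_concat)
qed

lemma block_perm_permutes: "block_perm \<sigma> (map length vss) permutes {..<length (concat vss)}"
  unfolding block_perm_def by (rule mset_perm_of_list[OF block_perm_list])

lemma permute_block_perm:
  "permute_list (block_perm \<sigma> (map length vss)) (concat vss) = concat (permute_list \<sigma> vss)"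
proof -
  have "permute_list (block_perm \<sigma> (map length vss)) (concat vss) =
      concat (permute_list \<sigma> (map (map ((!) (concat vss))) (blocks (map length vss))))"
    unfolding block_perm_def using mset_perm_of_list(2)[OF block_perm_list] \<sigma>
    by (simp add: permute_perm_of_list map_concat permute_list_map)
  then show ?thesis by (simp add: map_blocks)
qed

end

context
  fixes \<tau>s :: "(nat \<Rightarrow> nat) list" and vss :: "'a list list"
  assumes \<tau>s: "list_all2 (\<lambda>vs \<tau>. \<tau> permutes {..<length vs}) vss \<tau>s"
begin

lemma sum_perm_list:
  "mset (concat (map2 permute_list \<tau>s (blocks (map length vss)))) = mset [0..<length (concat vss)]"
proof -
  have "map mset (map2 permute_list \<tau>s (blocks (map length vss))) = map mset (blocks (map length vss))"
    using \<tau>s by (intro nth_equalityI) (auto simp: list_all2_conv_all_nth length_nth_blocks)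
  then have "mset (concat (map2 permute_list \<tau>s (blocks (map length vss)))) = mset (concat (blocks (map length vss)))"
    by (simp add: mset_concat)
  then show ?thesis by (simp add: concat_blocks length_concat)
qed

lemma sum_perm_permutes: "sum_perm \<tau>s (map length vss) permutes {..<length (concat vss)}"
  unfolding sum_perm_def by (rule mset_perm_of_list[OF sum_perm_list])

lemma permute_sum_perm:
  "permute_list (sum_perm \<tau>s (map length vss)) (concat vss) = concat (map2 permute_list \<tau>s vss)"
proof -
  have map_map2: "map (map ((!) (concat vss))) (map2 permute_list \<tau>s bs) =
      map2 (\<lambda>\<tau>. map ((!) (concat vss)) \<circ> permute_list \<tau>) \<tau>s bs" for bs
    by (intro nth_equalityI) auto
  have "permute_list (sum_perm \<tau>s (map length vss)) (concat vss) =
      concat (map2 (\<lambda>\<tau>. map ((!) (concat vss)) \<circ> permute_list \<tau>) \<tau>s (blocks (map length vss)))"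
    unfolding sum_perm_def using mset_perm_of_list(2)[OF sum_perm_list]
    by (simp only: permute_perm_of_list map_concat map_map2)
  also have "map2 (\<lambda>\<tau>. map ((!) (concat vss)) \<circ> permute_list \<tau>) \<tau>s (blocks (map length vss)) =
      map2 permute_list \<tau>s (map (map ((!) (concat vss))) (blocks (map length vss)))"
    using \<tau>s by (intro nth_equalityI) (auto simp: list_all2_conv_all_nth length_nth_blocks permute_list_map)
  finally show ?thesis by (simp add: map_blocks)
qed

end

section \<open>The free algebra is an algebra over the operad, modulo the relations\<close>

definition symbols :: "('r, 'o) operad_data \<Rightarrow> ('o \<times> 'v list) set" where
  "symbols P = {(\<mu>, vs). \<mu> \<in> ops P (length vs)}"

lemma Union_sym_tensors: "(\<Union>n. sym_tensors P n) = symbols P"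
  by (auto simp: symbols_def sym_tensors_def)

text \<open>
  The operation \<open>\<mu>\<close> on pure tensors, the entry \<open>(\<nu>, vs)\<close> standing for \<open>\<nu> \<otimes> vs\<close>.
\<close>

definition tcomp :: "('r, 'o) operad_data \<Rightarrow> 'o \<Rightarrow> ('o \<times> 'v list) list \<Rightarrow> 'o \<times> 'v list" where
  "tcomp P \<mu> xs = (op_comp P (map (length \<circ> snd) xs) \<mu> (map fst xs), concat (map snd xs))"

lemma ops_list_symbols:
  "set xs \<subseteq> symbols P \<Longrightarrow> ops_list P (map (length \<circ> snd) xs) (map fst xs)"
  by (induction xs) (auto simp: symbols_def)

lemma formal_op_mlin: "formal_op P \<mu> fs = mlin fs (\<lambda>xs. sg (tcomp P \<mu> xs))"
  by (simp add: formal_op_def mlin_eq_sum tcomp_def)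

locale free_algebra = symm_operad P
  for P :: "('r::comm_ring_1, 'o::ab_group_add) operad_data" +
  fixes sV :: "'r \<Rightarrow> 'v::ab_group_add \<Rightarrow> 'v"
  assumes V_module: "module sV"
begin

abbreviation cong (infix "\<approx>" 50) where "f \<approx> g \<equiv> f - g \<in> relmod P sV"

lemma subspace_relmod: "free.subspace (relmod P sV)"
  by (simp add: relmod_def)

lemma cong_refl [simp]: "f \<approx> f"
  by (simp add: free.subspace_0[OF subspace_relmod])

lemma cong_sym: "f \<approx> g \<Longrightarrow> g \<approx> f"
  using free.subspace_neg[OF subspace_relmod, of "f - g"] by simp

lemma cong_trans: "f \<approx> g \<Longrightarrow> g \<approx> h \<Longrightarrow> f \<approx> h"
  using free.subspace_add[OF subspace_relmod, of "f - g" "g - h"] by simp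

lemma cong_add: "f \<approx> f' \<Longrightarrow> g \<approx> g' \<Longrightarrow> f + g \<approx> f' + g'"
  using free.subspace_add[OF subspace_relmod, of "f - f'" "g - g'"] by (simp add: algebra_simps)

lemma cong_scale: "f \<approx> g \<Longrightarrow> free_scale c f \<approx> free_scale c g"
  using free.subspace_scale[OF subspace_relmod, of "f - g" c] by (simp add: free.scale_right_diff_distrib)

lemma cong_sum: "(\<And>i. i \<in> A \<Longrightarrow> f i \<approx> g i) \<Longrightarrow> sum f A \<approx> sum g A"
  using free.subspace_sum[OF subspace_relmod, of A "\<lambda>i. f i - g i"] by (simp add: sum_subtractf)

lemma ops_add: "\<mu> \<in> ops P n \<Longrightarrow> \<nu> \<in> ops P n \<Longrightarrow> \<mu> + \<nu> \<in> ops P n"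
  using module.subspace_add[OF module ops_submodule] .

lemma ops_scale: "\<mu> \<in> ops P n \<Longrightarrow> op_scale P c \<mu> \<in> ops P n"
  using module.subspace_scale[OF module ops_submodule] .

lemma cong_op_add:
  "\<mu> \<in> ops P (length vs) \<Longrightarrow> \<nu> \<in> ops P (length vs) \<Longrightarrow> sg (\<mu> + \<nu>, vs) \<approx> sg (\<mu>, vs) + sg (\<nu>, vs)"
  unfolding relmod_def by (intro free.span_base tensor_rels.op_add)

lemma cong_op_scale:
  "\<mu> \<in> ops P (length vs) \<Longrightarrow> sg (op_scale P c \<mu>, vs) \<approx> Poly_Mapping.single (\<mu>, vs) c"
  unfolding relmod_def by (intro free.span_base tensor_rels.op_scale)

lemma cong_arg_add:
  "\<mu> \<in> ops P (length vs) \<Longrightarrow> i < length vs \<Longrightarrow>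
    sg (\<mu>, vs[i := v + w]) \<approx> sg (\<mu>, vs[i := v]) + sg (\<mu>, vs[i := w])"
  unfolding relmod_def by (intro free.span_base tensor_rels.arg_add)

lemma cong_arg_scale:
  "\<mu> \<in> ops P (length vs) \<Longrightarrow> i < length vs \<Longrightarrow>
    sg (\<mu>, vs[i := sV c v]) \<approx> Poly_Mapping.single (\<mu>, vs[i := v]) c"
  unfolding relmod_def by (intro free.span_base tensor_rels.arg_scale)

lemma cong_symm:
  "\<mu> \<in> ops P (length vs) \<Longrightarrow> \<sigma> permutes {..<length vs} \<Longrightarrow>
    sg (op_act P (length vs) \<sigma> \<mu>, permute_list \<sigma> vs) \<approx> sg (\<mu>, vs)"
  unfolding relmod_def by (intro free.span_base tensor_rels.symm)

lemma tensor_rels_keys: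
  assumes "f \<in> tensor_rels P sV"
  shows "Poly_Mapping.keys f \<subseteq> symbols P"
proof -
  let ?K = "{f. Poly_Mapping.keys f \<subseteq> symbols P}"
  have single: "Poly_Mapping.single (\<mu>, vs) c \<in> ?K" if "\<mu> \<in> ops P (length vs)" for \<mu> vs and c :: 'r
    using that by (auto simp: symbols_def)
  note closed = free.subspace_diff[OF subspace_keys] free.subspace_add[OF subspace_keys] single
  have "f \<in> ?K"
    using assms
  proof cases
    case (op_add \<mu> vs \<nu>) then show ?thesis by (simp only:) (intro closed ops_add)
  next
    case (op_scale \<mu> vs c) then show ?thesis by (simp only:) (intro closed ops_scale)
  next
    case (arg_add \<mu> vs i v w) then show ?thesis by (simp only:) (intro closed, simp_all)
  next
    case (arg_scale \<mu> vs i c v) then show ?thesis by (simp only:) (intro closed, simp_all)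
  next
    case (symm \<mu> vs \<sigma>) then show ?thesis by (simp only:) (intro closed, simp_all add: act_closed)
  qed
  then show ?thesis by simp
qed

lemma relmod_keys: "f \<in> relmod P sV \<Longrightarrow> Poly_Mapping.keys f \<subseteq> symbols P"
  using free.span_minimal[OF _ subspace_keys, of "tensor_rels P sV" "symbols P"] tensor_rels_keys
  unfolding relmod_def by auto

lemma tcomp_closed:
  assumes "\<mu> \<in> ops P (length xs)" "set xs \<subseteq> symbols P"
  shows "tcomp P \<mu> xs \<in> symbols P"
proof -
  have "ops_list P (map (length \<circ> snd) xs) (map fst xs)"
    using assms(2) by (rule ops_list_symbols)
  then show ?thesis
    using comp_closed[of \<mu> "map (length \<circ> snd) xs" "map fst xs"] assms(1)
    by (simp add: symbols_def tcomp_def length_concat comp_def)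
qed

text \<open>
  Equivariance with the permutations \<open>id, \<dots>, id, \<sigma>, id, \<dots>, id\<close> moves a symmetry relation in
  one argument to a symmetry relation of the value.
\<close>

lemma tcomp_perm_slot:
  assumes \<mu>: "\<mu> \<in> ops P (Suc (length xs + length ys))"
    and xs: "set xs \<subseteq> symbols P" and ys: "set ys \<subseteq> symbols P"
    and \<nu>: "\<nu> \<in> ops P (length vs)" and \<sigma>: "\<sigma> permutes {..<length vs}"
  shows "sg (tcomp P \<mu> (xs @ (op_act P (length vs) \<sigma> \<nu>, permute_list \<sigma> vs) # ys)) \<approx>
         sg (tcomp P \<mu> (xs @ (\<nu>, vs) # ys))"
proof -
  let ?zs = "xs @ (\<nu>, vs) # ys"
  let ?vss = "map snd ?zs" and ?\<nu>s = "map fst ?zs"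
  let ?\<tau>s = "map (\<lambda>_. id) xs @ \<sigma> # map (\<lambda>_. id) ys"
  let ?ns = "map length ?vss"
  have zs: "set ?zs \<subseteq> symbols P" using xs ys \<nu> by (auto simp: symbols_def)
  then have ol: "ops_list P ?ns ?\<nu>s"
    using ops_list_symbols[of ?zs P] by (simp only: map_map)
  have \<tau>s: "list_all2 (\<lambda>vs \<tau>. \<tau> permutes {..<length vs}) ?vss ?\<tau>s"
    using \<sigma> by (simp add: list_all2_append list_all2_conv_all_nth[of _ "map snd _"] permutes_id)
  have \<tau>s': "list_all2 (\<lambda>n \<tau>. \<tau> permutes {..<n}) ?ns ?\<tau>s"
    using \<tau>s by (simp only: list_all2_map1)
  have "map (\<lambda>i. op_act P (?ns ! i) (?\<tau>s ! i) (?\<nu>s ! i)) [0..<length ?ns] =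
      map fst (xs @ (op_act P (length vs) \<sigma> \<nu>, permute_list \<sigma> vs) # ys)"
    (is "?l = ?r")
  proof (rule nth_equalityI)
    fix i assume i: "i < length ?l"
    have "?\<nu>s ! i \<in> ops P (?ns ! i)" using ol i by (simp add: list_all2_conv_all_nth del: map_append list.map)
    then show "?l ! i = ?r ! i" using i
      by (auto simp: nth_append nth_Cons act_id comp_def simp del: upt_Suc split: nat.splits if_splits)
  qed simp
  then have "op_comp P ?ns \<mu> (map fst (xs @ (op_act P (length vs) \<sigma> \<nu>, permute_list \<sigma> vs) # ys)) =
      op_act P (length (concat ?vss)) (sum_perm ?\<tau>s ?ns) (op_comp P ?ns \<mu> ?\<nu>s)"
    using equivariance_right[of \<mu> ?ns ?\<nu>s ?\<tau>s] \<mu> ol \<tau>s' by (simp add: length_concat comp_def)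
  moreover have "concat (map snd (xs @ (op_act P (length vs) \<sigma> \<nu>, permute_list \<sigma> vs) # ys)) =
      permute_list (sum_perm ?\<tau>s ?ns) (concat ?vss)"
  proof -
    have "map2 permute_list (map (\<lambda>_. id) us) us' = us'" if "length us = length us'"
      for us :: "'o list" and us' :: "'v list list"
      using that by (intro nth_equalityI) auto
    note this[of "map fst xs" "map snd xs"] this[of "map fst ys" "map snd ys"]
    then show ?thesis
      unfolding permute_sum_perm[OF \<tau>s] by (simp add: comp_def)
  qed
  ultimately have "tcomp P \<mu> (xs @ (op_act P (length vs) \<sigma> \<nu>, permute_list \<sigma> vs) # ys) =
     (op_act P (length (concat ?vss)) (sum_perm ?\<tau>s ?ns) (op_comp P ?ns \<mu> ?\<nu>s),
      permute_list (sum_perm ?\<tau>s ?ns) (concat ?vss))"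
    by (simp add: tcomp_def)
  moreover have "op_comp P ?ns \<mu> ?\<nu>s \<in> ops P (length (concat ?vss))"
    using comp_closed[OF _ ol] \<mu> by (simp add: length_concat comp_def)
  ultimately show ?thesis
    using cong_symm[of "op_comp P ?ns \<mu> ?\<nu>s" "concat ?vss"] sum_perm_permutes[OF \<tau>s]
    by (simp add: tcomp_def comp_def)
qed

text \<open>
  Each kind of relation in one argument is carried by an operation to a relation of the same kind:
  those in the operation by multilinearity of the operadic composition, those in the vectors because
  the vectors of an argument are a segment of the vectors of the value, the symmetries by
  equivariance.
\<close>

lemma relmod_slot:
  assumes \<mu>: "\<mu> \<in> ops P (Suc (length xs + length ys))"
    and xs: "set xs \<subseteq> symbols P" and ys: "set ys \<subseteq> symbols P"
    and f: "f \<in> relmod P sV"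
  shows "lin (\<lambda>y. sg (tcomp P \<mu> (xs @ y # ys))) f \<in> relmod P sV" (is "lin ?h f \<in> _")
proof -
  let ?A = "concat (map snd xs)" and ?C = "concat (map snd ys)"
  let ?ns = "\<lambda>n. map (length \<circ> snd) xs @ n # map (length \<circ> snd) ys"
  let ?\<nu>s = "\<lambda>\<nu>. map fst xs @ \<nu> # map fst ys"
  let ?c = "\<lambda>\<nu> n. op_comp P (?ns n) \<mu> (?\<nu>s \<nu>)"
  have tc: "tcomp P \<mu> (xs @ (\<nu>, vs) # ys) = (?c \<nu> (length vs), ?A @ vs @ ?C)" for \<nu> vs
    by (simp add: tcomp_def)
  have ol: "ops_list P (?ns n) (?\<nu>s \<nu>)" if "\<nu> \<in> ops P n" for \<nu> n
    using ops_list_symbols[OF xs] ops_list_symbols[OF ys] that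
    by (intro list_all2_appendI list.rel_intros)
  have cl: "?c \<nu> (length vs) \<in> ops P (length (?A @ vs @ ?C))" if "\<nu> \<in> ops P (length vs)" for \<nu> and vs :: "'v list"
    using comp_closed[OF _ ol[OF that]] \<mu> by (simp add: length_concat comp_def)
  have upd: "?A @ vs[i := v] @ ?C = (?A @ vs @ ?C)[length ?A + i := v]" if "i < length vs" for vs i v
    using that by (simp add: list_update_append)
  have len: "i < length vs \<Longrightarrow> length ?A + i < length (?A @ vs @ ?C)" for vs :: "'v list" and i
    by simp
  have "lin ?h r \<in> relmod P sV" if "r \<in> tensor_rels P sV" for r
    using that
  proof cases
    case (op_add \<nu> vs \<nu>')
    have "?c (\<nu> + \<nu>') (length vs) = ?c \<nu> (length vs) + ?c \<nu>' (length vs)"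
      using comp_add_right[of \<mu> "?ns (length vs)" "?\<nu>s \<nu>" "length xs" \<nu> \<nu>'] \<mu> ol[OF op_add(2)] op_add
      by (simp add: nth_append list_update_append)
    then show ?thesis
      using cong_op_add[OF cl[OF op_add(2)] cl[OF op_add(3)]] op_add(1) by (simp add: lin_diff lin_add tc)
  next
    case (op_scale \<nu> vs c)
    have "?c (op_scale P c \<nu>) (length vs) = operad_data.op_scale P c (?c \<nu> (length vs))"
      using comp_scale_right[of \<mu> "?ns (length vs)" "?\<nu>s \<nu>" "length xs" \<nu> c] \<mu> ol[OF op_scale(2)] op_scale
      by (simp add: nth_append list_update_append)
    then show ?thesis
      using cong_op_scale[OF cl[OF op_scale(2)], of c] op_scale(1) by (simp add: lin_diff tc)
  next
    case (arg_add \<nu> vs i v w)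
    then show ?thesis
      using cong_arg_add[OF cl[OF arg_add(2)] len[OF arg_add(3)], of v w]
      by (simp add: lin_diff lin_add tc upd del: append_assoc)
  next
    case (arg_scale \<nu> vs i c v)
    then show ?thesis
      using cong_arg_scale[OF cl[OF arg_scale(2)] len[OF arg_scale(3)], of c v]
      by (simp add: lin_diff tc upd del: append_assoc)
  next
    case (symm \<nu> vs \<sigma>)
    then show ?thesis
      using tcomp_perm_slot[OF \<mu> xs ys symm(2,3)] by (simp add: lin_diff)
  qed
  then show ?thesis
    using free.span_minimal[OF _ subspace_lin_vimage[OF subspace_relmod], of "tensor_rels P sV" ?h] f
    unfolding relmod_def by auto
qed

end

lemma list_all2_keys:
  "list_all2 (\<lambda>x f. x \<in> Poly_Mapping.keys f) xs fs \<Longrightarrow> set fs \<subseteq> {f. Poly_Mapping.keys f \<subseteq> S} \<Longrightarrow> set xs \<subseteq> S"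
  by (induction rule: list_all2_induct) auto

lemma permute_list_update:
  assumes "\<sigma> permutes {..<length xs}" "i < length xs"
  shows "permute_list \<sigma> (xs[\<sigma> i := y]) = (permute_list \<sigma> xs)[i := y]"
proof (rule nth_equalityI)
  fix j assume j: "j < length (permute_list \<sigma> (xs[\<sigma> i := y]))"
  have "\<sigma> j < length xs" "\<sigma> i < length xs"
    using assms j permutes_in_image[OF assms(1)] by auto
  then show "permute_list \<sigma> (xs[\<sigma> i := y]) ! j = (permute_list \<sigma> xs)[i := y] ! j"
    using j assms by (simp add: permute_list_nth nth_list_update inj_eq[OF permutes_inj[OF assms(1)]])
qed simp

context free_algebra
begin

abbreviation formals :: "(('o \<times> 'v list) \<Rightarrow>\<^sub>0 'r) set" where
  "formals \<equiv> {f. Poly_Mapping.keys f \<subseteq> symbols P}"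

abbreviation graded :: "nat \<Rightarrow> (('o \<times> 'v list) \<Rightarrow>\<^sub>0 'r) set" where
  "graded n \<equiv> {f. Poly_Mapping.keys f \<subseteq> sym_tensors P n}"

lemma graded_formals: "graded n \<subseteq> formals"
  by (auto simp: symbols_def sym_tensors_def)

lemma keys_slot_closed:
  assumes "list_all2 (\<lambda>x f. x \<in> Poly_Mapping.keys f) xs fs" "set fs \<subseteq> formals"
  shows "length xs = length fs" "set xs \<subseteq> symbols P"
  using list_all2_lengthD[OF assms(1)] list_all2_keys[OF assms] by auto

lemma formal_op_slot_cong:
  assumes \<mu>: "\<mu> \<in> ops P (length fs)" and fs: "set fs \<subseteq> formals" and i: "i < length fs" and "f \<approx> g"
  shows "formal_op P \<mu> (fs[i := f]) \<approx> formal_op P \<mu> (fs[i := g])"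
proof -
  have tk: "set (take i fs) \<subseteq> formals" "set (drop (Suc i) fs) \<subseteq> formals"
    using fs set_take_subset[of i fs] set_drop_subset[of "Suc i" fs] by blast+
  have "mlin (fs[i := f - g]) (\<lambda>xs. sg (tcomp P \<mu> xs)) \<in> relmod P sV"
    unfolding mlin_update[OF i]
  proof (intro mlin_in_subspace[OF subspace_relmod])
    fix xs ys
    assume "list_all2 (\<lambda>x f. x \<in> Poly_Mapping.keys f) xs (take i fs)"
      and "list_all2 (\<lambda>x f. x \<in> Poly_Mapping.keys f) ys (drop (Suc i) fs)"
    note xs = keys_slot_closed[OF this(1) tk(1)] and ys = keys_slot_closed[OF this(2) tk(2)]
    show "lin (\<lambda>x. sg (tcomp P \<mu> (xs @ x # ys))) (f - g) \<in> relmod P sV"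
    proof (rule relmod_slot)
      have "Suc (length xs + length ys) = length fs" using xs(1) ys(1) i by simp
      then show "\<mu> \<in> ops P (Suc (length xs + length ys))" using \<mu> by simp
    qed (use xs ys \<open>f \<approx> g\<close> in auto)
  qed
  then show ?thesis
    by (simp add: formal_op_mlin mlin_update_diff[OF i])
qed

text \<open>
  The arguments are exchanged one by one, those on the left having been exchanged already.
\<close>

lemma formal_op_cong:
  assumes "list_all2 (\<approx>) fs gs" "set fs \<subseteq> formals" "set gs \<subseteq> formals" "\<mu> \<in> ops P (length fs)"
  shows "formal_op P \<mu> fs \<approx> formal_op P \<mu> gs"
proof -
  have "formal_op P \<mu> (hs @ fs) \<approx> formal_op P \<mu> (hs @ gs)"
    if "set hs \<subseteq> formals" "\<mu> \<in> ops P (length (hs @ fs))" for hs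
    using assms(1-3) that
  proof (induction arbitrary: hs rule: list_all2_induct)
    case (Cons f fs g gs)
    have "formal_op P \<mu> ((hs @ f # fs)[length hs := f]) \<approx> formal_op P \<mu> ((hs @ f # fs)[length hs := g])"
      using Cons by (intro formal_op_slot_cong) auto
    moreover have "formal_op P \<mu> ((hs @ [g]) @ fs) \<approx> formal_op P \<mu> ((hs @ [g]) @ gs)"
      using Cons.prems by (intro Cons.IH) auto
    ultimately show ?case by (auto intro: cong_trans)
  qed (simp add: free.subspace_0[OF subspace_relmod])
  from this[of "[]"] assms show ?thesis by simp
qed

lemma tcomp_add:
  assumes "\<mu> \<in> ops P (length xs)" "\<nu> \<in> ops P (length xs)" "set xs \<subseteq> symbols P"
  shows "sg (tcomp P (\<mu> + \<nu>) xs) \<approx> sg (tcomp P \<mu> xs) + sg (tcomp P \<nu> xs)"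
  using assms tcomp_closed[of \<mu> xs] tcomp_closed[of \<nu> xs]
  by (auto simp: tcomp_def symbols_def comp_add_left ops_list_symbols intro!: cong_op_add)

lemma tcomp_scale:
  assumes "\<mu> \<in> ops P (length xs)" "set xs \<subseteq> symbols P"
  shows "sg (tcomp P (op_scale P c \<mu>) xs) \<approx> free_scale c (sg (tcomp P \<mu> xs))"
  using assms tcomp_closed[of \<mu> xs]
  by (auto simp: tcomp_def symbols_def comp_scale_left ops_list_symbols intro!: cong_op_scale)

lemma formal_op_add_op:
  assumes "\<mu> \<in> ops P (length fs)" "\<nu> \<in> ops P (length fs)" "set fs \<subseteq> formals"
  shows "formal_op P (\<mu> + \<nu>) fs \<approx> formal_op P \<mu> fs + formal_op P \<nu> fs"
  unfolding formal_op_mlin mlin_diff_fun[symmetric] mlin_add_fun[symmetric]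
proof (rule mlin_in_subspace[OF subspace_relmod])
  fix xs assume "list_all2 (\<lambda>x f. x \<in> Poly_Mapping.keys f) xs fs"
  from keys_slot_closed[OF this assms(3)] assms
  show "sg (tcomp P (\<mu> + \<nu>) xs) \<approx> sg (tcomp P \<mu> xs) + sg (tcomp P \<nu> xs)"
    by (intro tcomp_add) auto
qed

lemma formal_op_scale_op:
  assumes "\<mu> \<in> ops P (length fs)" "set fs \<subseteq> formals"
  shows "formal_op P (op_scale P c \<mu>) fs \<approx> free_scale c (formal_op P \<mu> fs)"
  unfolding formal_op_mlin mlin_diff_fun[symmetric] mlin_scale_fun[symmetric]
proof (rule mlin_in_subspace[OF subspace_relmod])
  fix xs assume "list_all2 (\<lambda>x f. x \<in> Poly_Mapping.keys f) xs fs"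
  from keys_slot_closed[OF this assms(2)] assms
  show "sg (tcomp P (op_scale P c \<mu>) xs) \<approx> free_scale c (sg (tcomp P \<mu> xs))"
    by (intro tcomp_scale) auto
qed

text \<open>
  Equivariance of the algebra structure, from block permutations and the symmetry relation.
\<close>

lemma tcomp_act:
  assumes "\<mu> \<in> ops P (length xs)" "set xs \<subseteq> symbols P" "\<sigma> permutes {..<length xs}"
  shows "sg (tcomp P (op_act P (length xs) \<sigma> \<mu>) (permute_list \<sigma> xs)) \<approx> sg (tcomp P \<mu> xs)"
proof -
  let ?ns = "map (length \<circ> snd) xs" and ?vss = "map snd xs"
  have \<sigma>: "\<sigma> permutes {..<length ?vss}" using assms by simp
  have "op_comp P (permute_list \<sigma> ?ns) (op_act P (length xs) \<sigma> \<mu>) (permute_list \<sigma> (map fst xs)) =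
      op_act P (length (concat ?vss)) (block_perm \<sigma> ?ns) (op_comp P ?ns \<mu> (map fst xs))"
    using equivariance_left[of \<mu> ?ns "map fst xs" \<sigma>] assms ops_list_symbols[OF assms(2)]
    by (simp add: length_concat comp_def)
  then have "tcomp P (op_act P (length xs) \<sigma> \<mu>) (permute_list \<sigma> xs) =
      (op_act P (length (concat ?vss)) (block_perm \<sigma> (map length ?vss)) (op_comp P ?ns \<mu> (map fst xs)),
       permute_list (block_perm \<sigma> (map length ?vss)) (concat ?vss))"
    unfolding permute_block_perm[OF \<sigma>] using assms(3) by (simp add: tcomp_def permute_list_map)
  then show ?thesis
    using cong_symm[OF _ block_perm_permutes[OF \<sigma>], of "op_comp P ?ns \<mu> (map fst xs)"]
      tcomp_closed[OF assms(1,2)]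
    by (simp add: tcomp_def symbols_def)
qed

text \<open>
  This is an equality of symbols, not only a congruence: the operad is strictly associative, and
  so is concatenation.
\<close>

lemma tcomp_assoc:
  assumes "\<mu> \<in> ops P (length xss)" "list_all2 (\<lambda>\<nu> xs. \<nu> \<in> ops P (length xs)) \<nu>s xss"
    and "\<And>xs. xs \<in> set xss \<Longrightarrow> set xs \<subseteq> symbols P"
  shows "tcomp P (op_comp P (map length xss) \<mu> \<nu>s) (concat xss) = tcomp P \<mu> (map2 (tcomp P) \<nu>s xss)"
proof -
  let ?mss = "map (map (length \<circ> snd)) xss" and ?\<xi>ss = "map (map fst) xss"
  have len: "length \<nu>s = length xss" using assms(2) by (rule list_all2_lengthD)
  have "list_all2 (ops_list P) ?mss ?\<xi>ss"
  proof (rule list_all2_all_nthI)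
    fix i assume i: "i < length ?mss"
    then show "ops_list P (?mss ! i) (?\<xi>ss ! i)"
      using ops_list_symbols[OF assms(3), of "xss ! i"] by simp
  qed simp
  moreover have "ops_list P (map length ?mss) \<nu>s"
    using assms(2) by (simp add: list_all2_conv_all_nth)
  moreover have "map (\<lambda>i. op_comp P (?mss ! i) (\<nu>s ! i) (?\<xi>ss ! i)) [0..<length ?mss] =
      map fst (map2 (tcomp P) \<nu>s xss)"
    using len by (intro nth_equalityI) (auto simp: tcomp_def)
  moreover have "map sum_list ?mss = map (length \<circ> snd) (map2 (tcomp P) \<nu>s xss)"
    using len by (intro nth_equalityI) (auto simp: tcomp_def length_concat comp_def)
  moreover have "map (concat \<circ> map snd) xss = map snd (map2 (tcomp P) \<nu>s xss)"
    using len by (intro nth_equalityI) (auto simp: tcomp_def)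
  moreover have "concat (map snd (concat xss)) = concat (map (concat \<circ> map snd) xss)"
    by (induction xss) auto
  ultimately show ?thesis
    using assoc[of \<mu> ?mss \<nu>s ?\<xi>ss] assms(1)
    by (simp add: tcomp_def[of P _ "concat xss"] tcomp_def[of P \<mu> "map2 (tcomp P) \<nu>s xss"] map_concat comp_def)
qed

lemma formal_op_assoc:
  assumes "\<mu> \<in> ops P (length fss)" "list_all2 (\<lambda>\<nu> fs. \<nu> \<in> ops P (length fs)) \<nu>s fss"
    and "\<And>fs. fs \<in> set fss \<Longrightarrow> set fs \<subseteq> formals"
  shows "formal_op P (op_comp P (map length fss) \<mu> \<nu>s) (concat fss) =
    formal_op P \<mu> (map2 (formal_op P) \<nu>s fss)"
proof -
  have len: "length \<nu>s = length fss" using assms(2) by (rule list_all2_lengthD)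
  have "mlin (concat fss) (\<lambda>xs. sg (tcomp P (op_comp P (map length fss) \<mu> \<nu>s) xs)) =
      mlin (map2 (\<lambda>u fs. mlin fs (\<lambda>xs. sg (u xs))) (map (tcomp P) \<nu>s) fss) (\<lambda>xs. sg (tcomp P \<mu> xs))"
  proof (rule mlin_concat)
    fix xss assume xss: "list_all2 (list_all2 (\<lambda>x f. x \<in> Poly_Mapping.keys f)) xss fss"
    have "map length xss = map length fss"
      using xss by (auto simp: list_all2_conv_all_nth intro!: nth_equalityI)
    moreover have "tcomp P (op_comp P (map length xss) \<mu> \<nu>s) (concat xss) = tcomp P \<mu> (map2 (tcomp P) \<nu>s xss)"
    proof (rule tcomp_assoc)
      show "\<mu> \<in> ops P (length xss)" using xss assms(1) by (simp add: list_all2_lengthD)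
      show "list_all2 (\<lambda>\<nu> xs. \<nu> \<in> ops P (length xs)) \<nu>s xss"
        using xss assms(2) by (auto simp: list_all2_conv_all_nth)
      fix xs assume "xs \<in> set xss"
      then obtain i where "i < length xss" "xs = xss ! i" by (auto simp: in_set_conv_nth)
      then have "fss ! i \<in> set fss" "list_all2 (\<lambda>x f. x \<in> Poly_Mapping.keys f) xs (fss ! i)"
        using xss list_all2_nthD[OF xss] list_all2_lengthD[OF xss] by auto
      then show "set xs \<subseteq> symbols P" using assms(3) keys_slot_closed by blast
    qed
    moreover have "map2 (\<lambda>u xs. u xs) (map (tcomp P) \<nu>s) xss = map2 (tcomp P) \<nu>s xss"
      using len xss by (intro nth_equalityI) (auto simp: list_all2_lengthD)
    ultimately show "sg (tcomp P (op_comp P (map length fss) \<mu> \<nu>s) (concat xss)) =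
        sg (tcomp P \<mu> (map2 (\<lambda>u xs. u xs) (map (tcomp P) \<nu>s) xss))" by simp
  qed (simp add: len)
  moreover have "map2 (\<lambda>u fs. mlin fs (\<lambda>xs. sg (u xs))) (map (tcomp P) \<nu>s) fss =
      map2 (formal_op P) \<nu>s fss"
    using len by (intro nth_equalityI) (auto simp: formal_op_mlin)
  ultimately show ?thesis by (simp add: formal_op_mlin)
qed

text \<open>
  The symbol that stands for \<open>v \<in> V\<close> in the free algebra.
\<close>

definition \<iota>s :: "'v \<Rightarrow> 'o \<times> 'v list" where "\<iota>s v = (op_unit P, [v])"

abbreviation \<iota> :: "'v \<Rightarrow> (('o \<times> 'v list) \<Rightarrow>\<^sub>0 'r)" where "\<iota> v \<equiv> sg (\<iota>s v)"

lemma \<iota>s_closed: "\<iota>s v \<in> symbols P"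
  using unit_closed by (simp add: \<iota>s_def symbols_def)

lemma \<iota>_closed: "\<iota> v \<in> formals"
  using \<iota>s_closed by simp

lemma \<iota>_graded: "\<iota> v \<in> graded 1"
  using unit_closed by (simp add: \<iota>s_def sym_tensors_def)

lemma map_\<iota>_closed: "set (map \<iota> vs) \<subseteq> formals"
  using \<iota>s_closed by auto

lemma \<iota>_add: "\<iota> (v + w) \<approx> \<iota> v + \<iota> w"
  using cong_arg_add[of "op_unit P" "[v]" 0 v w] unit_closed by (simp add: \<iota>s_def)

lemma \<iota>_scale: "\<iota> (sV c v) \<approx> free_scale c (\<iota> v)"
  using cong_arg_scale[of "op_unit P" "[v]" 0 c v] unit_closed by (simp add: \<iota>s_def)

lemma tcomp_\<iota>s: "\<nu> \<in> ops P (length vs) \<Longrightarrow> tcomp P \<nu> (map \<iota>s vs) = (\<nu>, vs)"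
  using unit_right[of \<nu> "length vs"] by (simp add: tcomp_def \<iota>s_def comp_def map_replicate_const)

text \<open>
  Every symbol is obtained by an operation from elements of \<open>V\<close>. This is why derivations are
  determined by their values on \<open>V\<close>.
\<close>

lemma formal_op_\<iota>: "\<nu> \<in> ops P (length vs) \<Longrightarrow> formal_op P \<nu> (map \<iota> vs) = sg (\<nu>, vs)"
  using mlin_sg[of "map \<iota>s vs" "\<lambda>xs. sg (tcomp P \<nu> xs)"]
  by (simp add: formal_op_mlin tcomp_\<iota>s comp_def)

lemma formal_op_unit: "f \<in> formals \<Longrightarrow> formal_op P (op_unit P) [f] = f"
proof -
  assume f: "f \<in> formals"
  have "lin (\<lambda>x. sg (tcomp P (op_unit P) [x])) f = lin sg f"
    using f by (intro lin_cong) (auto simp: tcomp_def symbols_def unit_left)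
  then show ?thesis by (simp add: formal_op_mlin)
qed

lemma formal_op_closed:
  assumes "\<mu> \<in> ops P (length fs)" "set fs \<subseteq> formals"
  shows "formal_op P \<mu> fs \<in> formals"
  unfolding formal_op_mlin
proof (rule mlin_in_subspace[OF subspace_keys])
  fix xs assume "list_all2 (\<lambda>x f. x \<in> Poly_Mapping.keys f) xs fs"
  from keys_slot_closed[OF this assms(2)] assms(1)
  show "sg (tcomp P \<mu> xs) \<in> formals" by (simp add: tcomp_closed)
qed

lemma formal_op_graded:
  assumes "\<mu> \<in> ops P (length fs)" "list_all2 (\<lambda>f n. f \<in> graded n) fs ns"
  shows "formal_op P \<mu> fs \<in> graded (sum_list ns)"
  unfolding formal_op_mlin
proof (rule mlin_in_subspace[OF subspace_keys])
  fix xs assume xs: "list_all2 (\<lambda>x f. x \<in> Poly_Mapping.keys f) xs fs"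
  have "set fs \<subseteq> formals" using assms(2) graded_formals
    by (auto simp: list_all2_conv_all_nth in_set_conv_nth) blast
  from tcomp_closed[of \<mu> xs] keys_slot_closed[OF xs this] assms(1)
  have "tcomp P \<mu> xs \<in> symbols P" by simp
  moreover
  have "xs ! i \<in> sym_tensors P (ns ! i)" if "i < length ns" for i
    using list_all2_nthD2[OF xs, of i] list_all2_nthD2[OF assms(2), of i] that
      list_all2_lengthD[OF xs] list_all2_lengthD[OF assms(2)] by auto
  then have "map (length \<circ> snd) xs = ns"
    using xs assms(2)
    by (intro nth_equalityI) (auto simp: list_all2_conv_all_nth sym_tensors_def split_def)
  then have "length (snd (tcomp P \<mu> xs)) = sum_list ns"
    by (simp add: tcomp_def length_concat comp_def)
  ultimately show "sg (tcomp P \<mu> xs) \<in> graded (sum_list ns)"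
    by (auto simp: symbols_def sym_tensors_def)
qed

lemma formal_op_update_add:
  "i < length fs \<Longrightarrow> formal_op P \<mu> (fs[i := f + g]) = formal_op P \<mu> (fs[i := f]) + formal_op P \<mu> (fs[i := g])"
  by (simp add: formal_op_mlin mlin_update_add)

lemma formal_op_update_scale:
  "i < length fs \<Longrightarrow> formal_op P \<mu> (fs[i := free_scale c f]) = free_scale c (formal_op P \<mu> (fs[i := f]))"
  by (simp add: formal_op_mlin mlin_update_scale)

lemma formal_op_update_sum:
  "i < length fs \<Longrightarrow> formal_op P \<mu> (fs[i := sum g A]) = (\<Sum>j\<in>A. formal_op P \<mu> (fs[i := g j]))"
  by (simp add: formal_op_mlin mlin_update_sum)

lemma formal_op_update_zero: "i < length fs \<Longrightarrow> formal_op P \<mu> (fs[i := 0]) = 0"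
  by (simp add: formal_op_mlin mlin_update_zero)

end

section \<open>Derivations of formal combinations\<close>

text \<open>
  Replacing one input of a composite in all possible ways amounts to choosing a block and then
  an input of it. Applied to a composite operation, this is the compatibility of the Leibniz rule
  with composition.
\<close>

lemma sum_slots_concat:
  fixes H :: "'c list \<Rightarrow> 'd::comm_monoid_add"
  shows "(\<Sum>i<length (concat vss). H ((map a (concat vss))[i := b (concat vss ! i)])) =
   (\<Sum>j<length vss. \<Sum>i<length (vss ! j).
      H (concat ((map (map a) vss)[j := (map a (vss ! j))[i := b (vss ! j ! i)]])))"
proof (induction vss arbitrary: H)
  case (Cons vs vss)
  have split: "(\<Sum>i<m + n. g i) = (\<Sum>i<m. g i) + (\<Sum>i<n. g (m + i))" for g :: "nat \<Rightarrow> 'd" and m n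
    by (induction n) (auto simp: algebra_simps)
  have "(\<Sum>i<length (concat vss). H (map a vs @ (map a (concat vss))[i := b (concat vss ! i)])) =
      (\<Sum>j<length vss. \<Sum>i<length (vss ! j).
        H (map a vs @ concat ((map (map a) vss)[j := (map a (vss ! j))[i := b (vss ! j ! i)]])))"
    by (rule Cons.IH)
  then show ?case
    by (simp add: split list_update_append nth_append lessThan_Suc_eq_insert_0
          sum.reindex comp_def map_concat zero_notin_Suc_image del: sum.lessThan_Suc)
qed simp

context free_algebra
begin

text \<open>
  The Leibniz rule for \<open>\<nu>(v\<^sub>1, \<dots>, v\<^sub>n)\<close>, where \<open>\<gamma>\<close> prescribes the derivatives of the \<open>v\<^sub>i\<close>.
\<close>

definition der_symbol :: "('v \<Rightarrow> (('o \<times> 'v list) \<Rightarrow>\<^sub>0 'r)) \<Rightarrow> 'o \<times> 'v list \<Rightarrow> (('o \<times> 'v list) \<Rightarrow>\<^sub>0 'r)" where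
  "der_symbol \<gamma> x = (\<Sum>i<length (snd x). formal_op P (fst x) ((map \<iota> (snd x))[i := \<gamma> (snd x ! i)]))"

definition der_formal :: "('v \<Rightarrow> (('o \<times> 'v list) \<Rightarrow>\<^sub>0 'r)) \<Rightarrow> (('o \<times> 'v list) \<Rightarrow>\<^sub>0 'r) \<Rightarrow> (('o \<times> 'v list) \<Rightarrow>\<^sub>0 'r)" where
  "der_formal \<gamma> = lin (der_symbol \<gamma>)"

lemma der_formal_\<iota>: "\<gamma> v \<in> formals \<Longrightarrow> der_formal \<gamma> (\<iota> v) = \<gamma> v"
  by (simp add: der_formal_def der_symbol_def \<iota>s_def formal_op_unit)

lemma slot_closed: "set fs \<subseteq> formals \<Longrightarrow> f \<in> formals \<Longrightarrow> set (fs[i := f]) \<subseteq> formals"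
  using set_update_subset_insert[of fs i f] by blast

lemma der_symbol_closed:
  assumes "range \<gamma> \<subseteq> formals" "x \<in> symbols P"
  shows "der_symbol \<gamma> x \<in> formals"
  unfolding der_symbol_def
proof (intro free.subspace_sum[OF subspace_keys] formal_op_closed slot_closed map_\<iota>_closed)
  fix i show "\<gamma> (snd x ! i) \<in> formals" using assms(1) by blast
qed (use assms(2) in \<open>auto simp: symbols_def\<close>)

lemma der_formal_closed: "range \<gamma> \<subseteq> formals \<Longrightarrow> f \<in> formals \<Longrightarrow> der_formal \<gamma> f \<in> formals"
  unfolding der_formal_def by (intro lin_in_subspace[OF subspace_keys] der_symbol_closed) auto

lemma der_symbol_graded:
  assumes "\<And>v. \<gamma> v \<in> graded (Suc k)" "x \<in> sym_tensors P n"
  shows "der_symbol \<gamma> x \<in> graded (n + k)"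
  unfolding der_symbol_def
proof (intro free.subspace_sum[OF subspace_keys])
  fix i assume i: "i \<in> {..<length (snd x)}"
  have "list_all2 (\<lambda>f n. f \<in> graded n) ((map \<iota> (snd x))[i := \<gamma> (snd x ! i)])
      ((map (\<lambda>_. 1) (snd x))[i := Suc k])"
    using assms(1) \<iota>_graded
    by (intro list_all2_update_cong) (auto simp: list_all2_map1 list_all2_map2 list_all2_same)
  from formal_op_graded[OF _ this, of "fst x"]
  show "formal_op P (fst x) ((map \<iota> (snd x))[i := \<gamma> (snd x ! i)]) \<in> graded (n + k)"
    using assms(2) i by (auto simp: sym_tensors_def sum_list_update map_replicate_const sum_list_replicate)
qed

lemma der_formal_graded:
  "(\<And>v. \<gamma> v \<in> graded (Suc k)) \<Longrightarrow> f \<in> graded n \<Longrightarrow> der_formal \<gamma> f \<in> graded (n + k)"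
  unfolding der_formal_def by (intro lin_in_subspace[OF subspace_keys] der_symbol_graded) auto

text \<open>
  The left side differentiates all the inputs of a composite at once. By associativity
  and because a symbol is \<open>\<nu>(v\<^sub>1, \<dots>, v\<^sub>n)\<close>, the terms that belong to the inputs of one argument add up
  to the derivative of this argument.
\<close>

lemma der_symbol_tcomp:
  assumes \<gamma>: "range \<gamma> \<subseteq> formals" and \<mu>: "\<mu> \<in> ops P (length xs)" and xs: "set xs \<subseteq> symbols P"
  shows "der_symbol \<gamma> (tcomp P \<mu> xs) =
    (\<Sum>j<length xs. formal_op P \<mu> ((map sg xs)[j := der_symbol \<gamma> (xs ! j)]))"
proof -
  let ?vss = "map snd xs" and ?\<nu>s = "map fst xs"
  let ?\<kappa> = "op_comp P (map length ?vss) \<mu> ?\<nu>s"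
  let ?l = "\<lambda>j i. (map \<iota> (?vss ! j))[i := \<gamma> (?vss ! j ! i)]"
  have ops: "fst (xs ! j) \<in> ops P (length (snd (xs ! j)))" if "j < length xs" for j
    using subsetD[OF xs nth_mem[OF that]] by (simp add: symbols_def split_def)
  have "der_symbol \<gamma> (tcomp P \<mu> xs) =
      (\<Sum>i<length (concat ?vss). formal_op P ?\<kappa> ((map \<iota> (concat ?vss))[i := \<gamma> (concat ?vss ! i)]))"
    by (simp add: der_symbol_def tcomp_def)
  also have "\<dots> = (\<Sum>j<length ?vss. \<Sum>i<length (?vss ! j).
      formal_op P ?\<kappa> (concat ((map (map \<iota>) ?vss)[j := ?l j i])))"
    by (rule sum_slots_concat)
  also have "\<dots> = (\<Sum>j<length xs. \<Sum>i<length (snd (xs ! j)).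
      formal_op P \<mu> ((map sg xs)[j := formal_op P (fst (xs ! j)) (?l j i)]))"
  proof (intro sum.cong)
    fix j i assume "j \<in> {..<length xs}" and i: "i \<in> {..<length (snd (xs ! j))}"
    then have j: "j < length xs" by simp
    let ?fss = "(map (map \<iota>) ?vss)[j := ?l j i]"
    have "\<gamma> (?vss ! j ! i) \<in> formals" using \<gamma> by blast
    then have "set (?l j i) \<subseteq> formals" by (intro slot_closed map_\<iota>_closed)
    then have fss: "set fs \<subseteq> formals" if "fs \<in> set ?fss" for fs
    proof -
      have "fs \<in> insert (?l j i) (map \<iota> ` set ?vss)"
        using that set_update_subset_insert[of "map (map \<iota>) ?vss" j "?l j i"] by (simp only: set_map) blast
      then consider "fs = ?l j i" | vs where "fs = map \<iota> vs" by blast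
      then show ?thesis
        using \<open>set (?l j i) \<subseteq> formals\<close> map_\<iota>_closed by cases metis+
    qed
    have len: "map length ?fss = map length ?vss"
      using j by (intro nth_equalityI) (auto simp: nth_list_update)
    have "list_all2 (\<lambda>\<nu> fs. \<nu> \<in> ops P (length fs)) ?\<nu>s ?fss"
      using j ops by (auto simp: list_all2_conv_all_nth nth_list_update)
    from formal_op_assoc[OF _ this fss, of \<mu>] \<mu>
    have "formal_op P ?\<kappa> (concat ?fss) = formal_op P \<mu> (map2 (formal_op P) ?\<nu>s ?fss)"
      unfolding len by simp
    moreover have "map2 (formal_op P) ?\<nu>s ?fss = (map sg xs)[j := formal_op P (fst (xs ! j)) (?l j i)]"
      using j ops by (intro nth_equalityI) (auto simp: nth_list_update formal_op_\<iota>)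
    ultimately show "formal_op P ?\<kappa> (concat ?fss) =
        formal_op P \<mu> ((map sg xs)[j := formal_op P (fst (xs ! j)) (?l j i)])" by simp
  qed auto
  also have "\<dots> = (\<Sum>j<length xs. formal_op P \<mu> ((map sg xs)[j := der_symbol \<gamma> (xs ! j)]))"
    by (intro sum.cong) (auto simp: der_symbol_def formal_op_update_sum)
  finally show ?thesis .
qed

lemma der_formal_op:
  assumes \<gamma>: "range \<gamma> \<subseteq> formals" and \<mu>: "\<mu> \<in> ops P (length fs)" and fs: "set fs \<subseteq> formals"
  shows "der_formal \<gamma> (formal_op P \<mu> fs) =
    (\<Sum>j<length fs. formal_op P \<mu> (fs[j := der_formal \<gamma> (fs ! j)]))"
proof -
  have "der_formal \<gamma> (formal_op P \<mu> fs) = mlin fs (\<lambda>xs. der_symbol \<gamma> (tcomp P \<mu> xs))"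
    by (simp add: der_formal_def formal_op_mlin lin_mlin)
  also have "\<dots> = mlin fs (\<lambda>xs. \<Sum>j<length fs. formal_op P \<mu> ((map sg xs)[j := der_symbol \<gamma> (xs ! j)]))"
  proof (rule mlin_cong)
    fix xs assume "list_all2 (\<lambda>x f. x \<in> Poly_Mapping.keys f) xs fs"
    from keys_slot_closed[OF this fs] \<mu>
    show "der_symbol \<gamma> (tcomp P \<mu> xs) =
        (\<Sum>j<length fs. formal_op P \<mu> ((map sg xs)[j := der_symbol \<gamma> (xs ! j)]))"
      by (simp add: der_symbol_tcomp[OF \<gamma>])
  qed
  also have "\<dots> = (\<Sum>j<length fs. formal_op P \<mu> (fs[j := der_formal \<gamma> (fs ! j)]))"
    by (simp add: mlin_sum_fun formal_op_mlin der_formal_def mlin_update_lin)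
  finally show ?thesis .
qed

definition linear_into :: "('v \<Rightarrow> (('o \<times> 'v list) \<Rightarrow>\<^sub>0 'r)) \<Rightarrow> bool" where
  "linear_into \<gamma> \<longleftrightarrow> range \<gamma> \<subseteq> formals \<and> (\<forall>v w. \<gamma> (v + w) = \<gamma> v + \<gamma> w) \<and>
     (\<forall>c v. \<gamma> (sV c v) = free_scale c (\<gamma> v))"

lemma linear_intoD:
  assumes "linear_into \<gamma>"
  shows "range \<gamma> \<subseteq> formals" "\<gamma> v \<in> formals" "\<gamma> (v + w) = \<gamma> v + \<gamma> w" "\<gamma> (sV c v) = free_scale c (\<gamma> v)"
  using assms unfolding linear_into_def by blast+

lemma der_symbol_op_add:
  assumes "range \<gamma> \<subseteq> formals" "\<mu> \<in> ops P (length vs)" "\<nu> \<in> ops P (length vs)"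
  shows "der_symbol \<gamma> (\<mu> + \<nu>, vs) \<approx> der_symbol \<gamma> (\<mu>, vs) + der_symbol \<gamma> (\<nu>, vs)"
  unfolding der_symbol_def fst_conv snd_conv sum.distrib[symmetric]
proof (intro cong_sum formal_op_add_op slot_closed map_\<iota>_closed)
  fix i show "\<gamma> (vs ! i) \<in> formals" using assms(1) by blast
qed (use assms in auto)

lemma der_symbol_op_scale:
  assumes "range \<gamma> \<subseteq> formals" "\<mu> \<in> ops P (length vs)"
  shows "der_symbol \<gamma> (op_scale P c \<mu>, vs) \<approx> free_scale c (der_symbol \<gamma> (\<mu>, vs))"
  unfolding der_symbol_def fst_conv snd_conv free.scale_sum_right
proof (intro cong_sum formal_op_scale_op slot_closed map_\<iota>_closed)
  fix i show "\<gamma> (vs ! i) \<in> formals" using assms(1) by blast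
qed (use assms in auto)

text \<open>
  In each term of the Leibniz rule the input at position \<open>i\<close> enters through \<open>\<gamma>\<close> or through \<open>\<iota>\<close>;
  the first is linear, the second is linear modulo the relations.
\<close>

lemma der_term_update:
  assumes "j < length vs" "i < length vs"
  shows "(map \<iota> (vs[i := u]))[j := \<gamma> (vs[i := u] ! j)] =
    ((map \<iota> vs)[j := \<gamma> (vs ! j)])[i := (if i = j then \<gamma> u else \<iota> u)]"
  using assms by (intro nth_equalityI) (auto simp: nth_list_update)

lemma der_symbol_arg_add:
  assumes \<gamma>: "linear_into \<gamma>" and \<mu>: "\<mu> \<in> ops P (length vs)" and i: "i < length vs"
  shows "der_symbol \<gamma> (\<mu>, vs[i := v + w]) \<approx> der_symbol \<gamma> (\<mu>, vs[i := v]) + der_symbol \<gamma> (\<mu>, vs[i := w])"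
  unfolding der_symbol_def fst_conv snd_conv sum.distrib[symmetric] length_list_update
proof (intro cong_sum)
  fix j assume "j \<in> {..<length vs}"
  then have j: "j < length vs" by simp
  let ?fs = "(map \<iota> vs)[j := \<gamma> (vs ! j)]"
  have fs: "set ?fs \<subseteq> formals" by (intro slot_closed map_\<iota>_closed linear_intoD(2)[OF \<gamma>])
  have "(if i = j then \<gamma> (v + w) else \<iota> (v + w)) \<approx>
      (if i = j then \<gamma> v else \<iota> v) + (if i = j then \<gamma> w else \<iota> w)"
    using \<iota>_add[of v w] linear_intoD(3)[OF \<gamma>, of v w] cong_refl by (simp add: free.subspace_0[OF subspace_relmod])
  from formal_op_slot_cong[OF _ fs _ this, of \<mu> i] \<mu> i
  show "formal_op P \<mu> ((map \<iota> (vs[i := v + w]))[j := \<gamma> (vs[i := v + w] ! j)]) \<approx>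
      formal_op P \<mu> ((map \<iota> (vs[i := v]))[j := \<gamma> (vs[i := v] ! j)]) +
      formal_op P \<mu> ((map \<iota> (vs[i := w]))[j := \<gamma> (vs[i := w] ! j)])"
    unfolding der_term_update[OF j i] by (simp add: formal_op_update_add)
qed

lemma der_symbol_arg_scale:
  assumes \<gamma>: "linear_into \<gamma>" and \<mu>: "\<mu> \<in> ops P (length vs)" and i: "i < length vs"
  shows "der_symbol \<gamma> (\<mu>, vs[i := sV c v]) \<approx> free_scale c (der_symbol \<gamma> (\<mu>, vs[i := v]))"
  unfolding der_symbol_def fst_conv snd_conv free.scale_sum_right length_list_update
proof (intro cong_sum)
  fix j assume "j \<in> {..<length vs}"
  then have j: "j < length vs" by simp
  let ?fs = "(map \<iota> vs)[j := \<gamma> (vs ! j)]"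
  have fs: "set ?fs \<subseteq> formals" by (intro slot_closed map_\<iota>_closed linear_intoD(2)[OF \<gamma>])
  have "(if i = j then \<gamma> (sV c v) else \<iota> (sV c v)) \<approx> free_scale c (if i = j then \<gamma> v else \<iota> v)"
    using \<iota>_scale[of c v] linear_intoD(4)[OF \<gamma>, of c v] by (simp add: free.subspace_0[OF subspace_relmod])
  from formal_op_slot_cong[OF _ fs _ this, of \<mu> i] \<mu> i
  show "formal_op P \<mu> ((map \<iota> (vs[i := sV c v]))[j := \<gamma> (vs[i := sV c v] ! j)]) \<approx>
      free_scale c (formal_op P \<mu> ((map \<iota> (vs[i := v]))[j := \<gamma> (vs[i := v] ! j)]))"
    unfolding der_term_update[OF j i] by (simp add: formal_op_update_scale del: free_scale_single)
qed

lemma formal_op_\<iota>_slot: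
  assumes "i < length vs"
  shows "formal_op P \<mu> ((map \<iota> vs)[i := f]) = lin (\<lambda>y. sg (tcomp P \<mu> ((map \<iota>s vs)[i := y]))) f"
  using mlin_sg_update[of i "map \<iota>s vs" f "\<lambda>xs. sg (tcomp P \<mu> xs)"] assms
  by (simp add: formal_op_mlin comp_def)

text \<open>
  The terms of the two sums correspond under \<open>\<sigma>\<close>, and corresponding terms are congruent by
  equivariance. Only one argument of each term is not a symbol, so equivariance on symbols suffices.
\<close>

lemma der_symbol_symm:
  assumes \<gamma>: "range \<gamma> \<subseteq> formals" and \<mu>: "\<mu> \<in> ops P (length vs)" and \<sigma>: "\<sigma> permutes {..<length vs}"
  shows "der_symbol \<gamma> (op_act P (length vs) \<sigma> \<mu>, permute_list \<sigma> vs) \<approx> der_symbol \<gamma> (\<mu>, vs)"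
proof -
  have "der_symbol \<gamma> (\<mu>, vs) = (\<Sum>i<length vs. formal_op P \<mu> ((map \<iota> vs)[\<sigma> i := \<gamma> (vs ! \<sigma> i)]))"
    unfolding der_symbol_def using sum.permute[OF \<sigma>] by (simp add: comp_def)
  moreover have "formal_op P (op_act P (length vs) \<sigma> \<mu>) ((map \<iota> (permute_list \<sigma> vs))[i := \<gamma> (permute_list \<sigma> vs ! i)]) \<approx>
      formal_op P \<mu> ((map \<iota> vs)[\<sigma> i := \<gamma> (vs ! \<sigma> i)])" if i: "i < length vs" for i
  proof -
    have \<sigma>i: "\<sigma> i < length vs" using permutes_in_image[OF \<sigma>] i by auto
    let ?xs = "map \<iota>s vs"
    have "lin (\<lambda>y. sg (tcomp P (op_act P (length vs) \<sigma> \<mu>) ((permute_list \<sigma> ?xs)[i := y])) -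
        sg (tcomp P \<mu> (?xs[\<sigma> i := y]))) (\<gamma> (vs ! \<sigma> i)) \<in> relmod P sV"
    proof (rule lin_in_subspace[OF subspace_relmod])
      fix y assume "y \<in> Poly_Mapping.keys (\<gamma> (vs ! \<sigma> i))"
      then have "y \<in> symbols P" using \<gamma> by blast
      then have "set (?xs[\<sigma> i := y]) \<subseteq> symbols P"
        using set_update_subset_insert[of ?xs "\<sigma> i" y] \<iota>s_closed by auto
      from tcomp_act[OF _ this, of \<mu> \<sigma>] \<mu> \<sigma>
      show "sg (tcomp P (op_act P (length vs) \<sigma> \<mu>) ((permute_list \<sigma> ?xs)[i := y])) \<approx>
          sg (tcomp P \<mu> (?xs[\<sigma> i := y]))"
        using permute_list_update[of \<sigma> ?xs i y] i by simp
    qed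
    then show ?thesis
      using i \<sigma>i \<sigma> by (simp add: formal_op_\<iota>_slot lin_diff_fun permute_list_nth permute_list_map)
  qed
  ultimately show ?thesis
    unfolding der_symbol_def by (auto intro!: cong_sum)
qed

text \<open>
  By linearity the generating relations are enough, and these are the preceding congruences. The
  extension of \<open>\<gamma>\<close> by the Leibniz rule therefore passes to the free algebra.
\<close>

lemma der_formal_relmod:
  assumes \<gamma>: "linear_into \<gamma>" and f: "f \<in> relmod P sV"
  shows "der_formal \<gamma> f \<in> relmod P sV"
proof -
  note \<gamma>' = linear_intoD(1)[OF \<gamma>]
  have "lin (der_symbol \<gamma>) g \<in> relmod P sV" if "g \<in> tensor_rels P sV" for g
    using that
  proof cases
    case (op_add \<mu> vs \<nu>)
    then show ?thesis using der_symbol_op_add[OF \<gamma>', of \<mu> vs \<nu>] by (simp add: lin_diff lin_add)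
  next
    case (op_scale \<mu> vs c)
    then show ?thesis using der_symbol_op_scale[OF \<gamma>', of \<mu> vs c] by (simp add: lin_diff)
  next
    case (arg_add \<mu> vs i v w)
    then show ?thesis using der_symbol_arg_add[OF \<gamma>, of \<mu> vs i v w] by (simp add: lin_diff lin_add)
  next
    case (arg_scale \<mu> vs i c v)
    then show ?thesis using der_symbol_arg_scale[OF \<gamma>, of \<mu> vs i c v] by (simp add: lin_diff)
  next
    case (symm \<mu> vs \<sigma>)
    then show ?thesis using der_symbol_symm[OF \<gamma>', of \<mu> vs \<sigma>] by (simp add: lin_diff)
  qed
  then show ?thesis
    using free.span_minimal[OF _ subspace_lin_vimage[OF subspace_relmod], of "tensor_rels P sV" "der_symbol \<gamma>"] f
    unfolding relmod_def der_formal_def by auto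
qed

lemma der_formal_cong: "linear_into \<gamma> \<Longrightarrow> f \<approx> g \<Longrightarrow> der_formal \<gamma> f \<approx> der_formal \<gamma> g"
  using der_formal_relmod[of \<gamma> "f - g"] by (simp add: der_formal_def lin_diff)

end

section \<open>Derivations of the free algebra\<close>

lemma in_listset_iff: "xs \<in> listset As \<longleftrightarrow> list_all2 (\<in>) xs As"
proof (induction As arbitrary: xs)
  case (Cons A As)
  then show ?case by (cases xs) (auto simp: set_Cons_def)
qed simp

context free_algebra
begin

abbreviation cl :: "(('o \<times> 'v list) \<Rightarrow>\<^sub>0 'r) \<Rightarrow> (('o \<times> 'v list) \<Rightarrow>\<^sub>0 'r) set" where
  "cl \<equiv> coset P sV"

lemma mem_coset: "g \<in> cl f \<longleftrightarrow> g \<approx> f"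
  by (simp add: coset_def)

lemma coset_self: "f \<in> cl f"
  by (simp add: coset_def free.subspace_0[OF subspace_relmod])

lemma coset_eq_iff: "cl f = cl g \<longleftrightarrow> f \<approx> g"
proof
  assume "f \<approx> g"
  then have "h \<approx> f \<longleftrightarrow> h \<approx> g" for h
    using cong_trans[of h f g] cong_trans[of h g f] cong_sym[of f g] by blast
  then show "cl f = cl g" by (auto simp: mem_coset)
qed (use coset_self[of f] in \<open>simp add: mem_coset\<close>)

lemma coset_eqI: "f \<approx> g \<Longrightarrow> cl f = cl g"
  by (simp add: coset_eq_iff)

lemma fa_add_coset: "fa_add P sV (cl f) (cl g) = cl (f + g)"
proof -
  have "cl (x + y) = cl (f + g)" if "x \<in> cl f" "y \<in> cl g" for x y
    using that by (intro coset_eqI cong_add) (simp_all add: mem_coset)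
  then have "fa_add P sV (cl f) (cl g) = (\<Union>x\<in>cl f. \<Union>y\<in>cl g. cl (f + g))"
    unfolding fa_add_def by simp
  then show ?thesis using coset_self by blast
qed

lemma fa_scale_coset: "fa_scale P sV c (cl f) = cl (free_scale c f)"
proof -
  have "cl (free_scale c x) = cl (free_scale c f)" if "x \<in> cl f" for x
    using that by (intro coset_eqI cong_scale) (simp add: mem_coset)
  then have "fa_scale P sV c (cl f) = (\<Union>x\<in>cl f. cl (free_scale c f))"
    unfolding fa_scale_def by simp
  then show ?thesis using coset_self by blast
qed

lemma fa_sum_coset: "fa_sum P sV (map cl fs) = cl (sum_list fs)"
  by (induction fs) (simp_all add: fa_sum_def fa_zero_def fa_add_coset)

text \<open>
  The relations only involve symbols whose operation has the arity given by the number of vectors, so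
  that a change of representatives does not lead out of their span.
\<close>

lemma formals_cong: "f \<in> formals \<Longrightarrow> g \<approx> f \<Longrightarrow> g \<in> formals"
proof -
  assume "f \<in> formals" "g \<approx> f"
  then have "(g - f) + f \<in> formals"
    by (intro free.subspace_add[OF subspace_keys]) (use relmod_keys in auto)
  then show "g \<in> formals" by simp
qed

lemma fa_op_coset:
  assumes "\<mu> \<in> ops P (length fs)" "set fs \<subseteq> formals"
  shows "fa_op P sV \<mu> (map cl fs) = cl (formal_op P \<mu> fs)"
proof -
  have "cl (formal_op P \<mu> gs) = cl (formal_op P \<mu> fs)" if "gs \<in> listset (map cl fs)" for gs
  proof (rule coset_eqI, rule formal_op_cong)
    show "list_all2 (\<approx>) gs fs"
      using that by (simp add: in_listset_iff list_all2_map2 mem_coset)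
    then have "g \<in> formals" if g: "g \<in> set gs" for g
    proof -
      obtain i where i: "i < length gs" "g = gs ! i" using g by (auto simp: in_set_conv_nth)
      with list_all2_nthD[OF \<open>list_all2 (\<approx>) gs fs\<close>] list_all2_lengthD[OF \<open>list_all2 (\<approx>) gs fs\<close>]
      have "fs ! i \<in> set fs" "g \<approx> fs ! i" by auto
      then show ?thesis using assms(2) formals_cong by blast
    qed
    then show "set gs \<subseteq> formals" by blast
    show "\<mu> \<in> ops P (length gs)"
      using assms(1) list_all2_lengthD[OF \<open>list_all2 (\<approx>) gs fs\<close>] by simp
  qed (rule assms)
  moreover have "fs \<in> listset (map cl fs)"
    by (simp add: in_listset_iff list_all2_map2 list_all2_same coset_self)
  ultimately show ?thesis unfolding fa_op_def by blast
qed

lemma fa_carrier_eq: "fa_carrier P sV = cl ` formals"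
  by (simp add: fa_carrier_def Union_sym_tensors)

lemma fa_incl_eq: "fa_incl P sV v = cl (\<iota> v)"
  by (simp add: fa_incl_def \<iota>s_def)

lemma lists_fa_carrier: "as \<in> lists (fa_carrier P sV) \<Longrightarrow> \<exists>fs. as = map cl fs \<and> set fs \<subseteq> formals"
  unfolding fa_carrier_eq by (simp add: lists_image) (auto simp: image_iff lists_eq_set)

definition der_of :: "('v \<Rightarrow> (('o \<times> 'v list) \<Rightarrow>\<^sub>0 'r)) \<Rightarrow> ('r, 'o, 'v) fa_map" where
  "der_of \<gamma> = (\<lambda>X\<in>fa_carrier P sV. \<Union>f\<in>X. cl (der_formal \<gamma> f))"

lemma der_of_coset:
  assumes "linear_into \<gamma>" "f \<in> formals"
  shows "der_of \<gamma> (cl f) = cl (der_formal \<gamma> f)"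
proof -
  have "cl (der_formal \<gamma> g) = cl (der_formal \<gamma> f)" if "g \<in> cl f" for g
    using that by (intro coset_eqI der_formal_cong assms(1)) (simp add: mem_coset)
  then have "(\<Union>g\<in>cl f. cl (der_formal \<gamma> g)) = cl (der_formal \<gamma> f)"
    using coset_self by blast
  then show ?thesis
    using assms(2) unfolding der_of_def fa_carrier_eq by simp
qed

lemma der_of_Der:
  assumes \<gamma>: "linear_into \<gamma>"
  shows "der_of \<gamma> \<in> Der P sV"
proof -
  note closed = der_formal_closed[OF linear_intoD(1)[OF \<gamma>]]
  note simps = der_of_coset[OF \<gamma>] fa_add_coset fa_scale_coset
  have "der_of \<gamma> \<in> fa_carrier P sV \<rightarrow>\<^sub>E fa_carrier P sV"
  proof (intro PiE_I)
    fix Y assume "Y \<in> fa_carrier P sV"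
    then obtain f where "Y = cl f" "f \<in> formals" unfolding fa_carrier_eq by blast
    with closed[of f] show "der_of \<gamma> Y \<in> fa_carrier P sV"
      unfolding fa_carrier_eq by (simp only: der_of_coset[OF \<gamma>]) blast
  qed (simp add: der_of_def)
  moreover have "der_of \<gamma> (fa_add P sV Y Z) = fa_add P sV (der_of \<gamma> Y) (der_of \<gamma> Z)"
    if YZ: "Y \<in> fa_carrier P sV" "Z \<in> fa_carrier P sV" for Y Z
  proof -
    obtain f g where eq: "Y = cl f" "Z = cl g" and fg: "f \<in> formals" "g \<in> formals"
      using YZ unfolding fa_carrier_eq by blast
    show ?thesis
      using free.subspace_add[OF subspace_keys fg]
      by (simp only: eq simps fg) (simp add: der_formal_def lin_add)
  qed
  moreover have "der_of \<gamma> (fa_scale P sV c Y) = fa_scale P sV c (der_of \<gamma> Y)"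
    if Y: "Y \<in> fa_carrier P sV" for c Y
  proof -
    obtain f where eq: "Y = cl f" and f: "f \<in> formals"
      using Y unfolding fa_carrier_eq by blast
    show ?thesis
      using free.subspace_scale[OF subspace_keys f]
      by (simp only: eq simps f) (simp add: der_formal_def lin_scale)
  qed
  moreover have "der_of \<gamma> (fa_op P sV \<mu> as) =
      fa_sum P sV (map (\<lambda>i. fa_op P sV \<mu> (as[i := der_of \<gamma> (as ! i)])) [0..<length as])"
    if as: "as \<in> lists (fa_carrier P sV)" and \<mu>: "\<mu> \<in> ops P (length as)" for as \<mu>
  proof -
    from lists_fa_carrier[OF as] obtain fs where fs: "as = map cl fs" "set fs \<subseteq> formals" by blast
    have "fa_op P sV \<mu> (as[i := der_of \<gamma> (as ! i)]) = cl (formal_op P \<mu> (fs[i := der_formal \<gamma> (fs ! i)]))"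
      if "i < length fs" for i
    proof -
      have "fs ! i \<in> formals" using fs(2) nth_mem[OF that] by blast
      then have "as[i := der_of \<gamma> (as ! i)] = map cl (fs[i := der_formal \<gamma> (fs ! i)])"
        using that by (simp add: fs map_update der_of_coset[OF \<gamma>])
      then show ?thesis
        using fs \<mu> slot_closed[OF fs(2) closed[OF \<open>fs ! i \<in> formals\<close>], of i]
        by (simp only:) (intro fa_op_coset, auto)
    qed
    then have "map (\<lambda>i. fa_op P sV \<mu> (as[i := der_of \<gamma> (as ! i)])) [0..<length as] =
        map cl (map (\<lambda>i. formal_op P \<mu> (fs[i := der_formal \<gamma> (fs ! i)])) [0..<length fs])"
      by (simp add: fs)
    moreover have "der_of \<gamma> (fa_op P sV \<mu> as) = cl (der_formal \<gamma> (formal_op P \<mu> fs))"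
      using \<mu> fs formal_op_closed[of \<mu> fs] by (simp only: fs fa_op_coset length_map) (simp add: der_of_coset[OF \<gamma>])
    ultimately show ?thesis
      using der_formal_op[OF linear_intoD(1)[OF \<gamma>], of \<mu> fs] \<mu> fs
      by (simp only: fa_sum_coset) (simp add: interv_sum_list_conv_sum_set_nat atLeast0LessThan)
  qed
  ultimately show ?thesis
    unfolding Der_def by simp
qed

lemma der_of_incl: "linear_into \<gamma> \<Longrightarrow> der_of \<gamma> (fa_incl P sV v) = cl (\<gamma> v)"
  using der_formal_\<iota>[of \<gamma> v] linear_intoD(2)[of \<gamma> v] \<iota>_closed[of v]
  by (simp only: fa_incl_eq der_of_coset)

lemma Der_carrier: "d \<in> Der P sV \<Longrightarrow> f \<in> formals \<Longrightarrow> d (cl f) \<in> fa_carrier P sV"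
  unfolding Der_def fa_carrier_eq by blast

lemma Der_add: "d \<in> Der P sV \<Longrightarrow> f \<in> formals \<Longrightarrow> g \<in> formals \<Longrightarrow>
    d (cl (f + g)) = fa_add P sV (d (cl f)) (d (cl g))"
  unfolding Der_def fa_carrier_eq by (auto simp flip: fa_add_coset)

lemma Der_scale: "d \<in> Der P sV \<Longrightarrow> f \<in> formals \<Longrightarrow>
    d (cl (free_scale c f)) = fa_scale P sV c (d (cl f))"
  unfolding Der_def fa_carrier_eq by (auto simp flip: fa_scale_coset)

lemma Der_op:
  assumes "d \<in> Der P sV" "set fs \<subseteq> formals" "\<mu> \<in> ops P (length fs)"
  shows "d (cl (formal_op P \<mu> fs)) =
    fa_sum P sV (map (\<lambda>i. fa_op P sV \<mu> ((map cl fs)[i := d (cl (fs ! i))])) [0..<length fs])"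
proof -
  have "map cl fs \<in> lists (fa_carrier P sV)" using assms(2) unfolding fa_carrier_eq by (simp add: lists_eq_set image_mono)
  then have "d (fa_op P sV \<mu> (map cl fs)) =
      fa_sum P sV (map (\<lambda>i. fa_op P sV \<mu> ((map cl fs)[i := d (map cl fs ! i)])) [0..<length (map cl fs)])"
    using assms(1,3) unfolding Der_def by auto
  moreover have "map (\<lambda>i. fa_op P sV \<mu> ((map cl fs)[i := d (map cl fs ! i)])) [0..<length fs] =
      map (\<lambda>i. fa_op P sV \<mu> ((map cl fs)[i := d (cl (fs ! i))])) [0..<length fs]"
    by (intro map_cong refl) simp
  ultimately show ?thesis
    by (simp only: fa_op_coset[OF assms(3,2)] length_map)
qed

text \<open>
  The equality at \<open>0\<close> follows from homogeneity, \<open>d 0 = d (0 \<cdot> 0) = 0 \<cdot> d 0\<close>.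
\<close>

lemma subspace_agree:
  assumes d: "d \<in> Der P sV" and e: "e \<in> Der P sV"
  shows "free.subspace {f \<in> formals. d (cl f) = e (cl f)}"
proof -
  let ?S = "{f \<in> formals. d (cl f) = e (cl f)}"
  have "d (cl 0) = e (cl 0)"
  proof -
    obtain f g where "d (cl 0) = cl f" "e (cl 0) = cl g"
      using Der_carrier[OF d, of 0] Der_carrier[OF e, of 0] unfolding fa_carrier_eq by auto
    then show ?thesis
      using Der_scale[OF d, of 0 0] Der_scale[OF e, of 0 0] by (simp add: fa_scale_coset)
  qed
  then have zero: "0 \<in> ?S" by simp
  have add: "f + g \<in> formals" "d (cl (f + g)) = e (cl (f + g))"
    if "f \<in> formals" "g \<in> formals" "d (cl f) = e (cl f)" "d (cl g) = e (cl g)" for f g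
    using free.subspace_add[OF subspace_keys that(1,2)] that(3,4)
    by (simp_all only: Der_add[OF d that(1,2)] Der_add[OF e that(1,2)])
  have scale: "free_scale c f \<in> formals" "d (cl (free_scale c f)) = e (cl (free_scale c f))"
    if "f \<in> formals" "d (cl f) = e (cl f)" for c f
    using free.subspace_scale[OF subspace_keys that(1)] that(2)
    by (simp_all only: Der_scale[OF d that(1)] Der_scale[OF e that(1)])
  show ?thesis
    unfolding free.subspace_def
  proof (intro conjI ballI allI zero)
    show "f + g \<in> ?S" if "f \<in> ?S" "g \<in> ?S" for f g
      using that add[of f g] by (simp only: mem_Collect_eq)
    show "free_scale c f \<in> ?S" if "f \<in> ?S" for c f
      using that scale[of f c] by (simp only: mem_Collect_eq)
  qed
qed

text \<open>
  Uniqueness of derivations with prescribed values on \<open>V\<close>: by linearity symbols are enough, and a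
  symbol is an operation applied to elements of \<open>V\<close>.
\<close>

lemma Der_ext:
  assumes d: "d \<in> Der P sV" and e: "e \<in> Der P sV"
    and agree: "\<And>v. d (fa_incl P sV v) = e (fa_incl P sV v)"
  shows "d = e"
proof (rule extensionalityI[of _ "fa_carrier P sV"])
  show "d \<in> extensional (fa_carrier P sV)" "e \<in> extensional (fa_carrier P sV)"
    using d e by (auto simp: Der_def PiE_def)
  fix X assume "X \<in> fa_carrier P sV"
  then obtain f where X: "X = cl f" and f: "f \<in> formals" unfolding fa_carrier_eq by blast
  have "f \<in> {f \<in> formals. d (cl f) = e (cl f)}"
  proof (rule free_subspace_induct[OF subspace_agree[OF d e]])
    fix x assume "x \<in> Poly_Mapping.keys f"
    then obtain \<mu> vs where x: "x = (\<mu>, vs)" and \<mu>: "\<mu> \<in> ops P (length vs)"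
      using f by (auto simp: symbols_def)
    have "d (cl (map \<iota> vs ! i)) = e (cl (map \<iota> vs ! i))" if "i < length vs" for i
      using agree that by (simp add: fa_incl_eq)
    then have "map (\<lambda>i. fa_op P sV \<mu> ((map cl (map \<iota> vs))[i := d (cl (map \<iota> vs ! i))])) [0..<length (map \<iota> vs)] =
        map (\<lambda>i. fa_op P sV \<mu> ((map cl (map \<iota> vs))[i := e (cl (map \<iota> vs ! i))])) [0..<length (map \<iota> vs)]"
      by (intro map_cong refl) (simp only: set_upt atLeastLessThan_iff length_map)
    then have "d (cl (formal_op P \<mu> (map \<iota> vs))) = e (cl (formal_op P \<mu> (map \<iota> vs)))"
      using \<mu> by (simp only: Der_op[OF d map_\<iota>_closed] Der_op[OF e map_\<iota>_closed] length_map)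
    then show "sg x \<in> {f \<in> formals. d (cl f) = e (cl f)}"
      using \<mu> by (simp add: formal_op_\<iota> x symbols_def)
  qed
  then show "d X = e X" by (simp add: X)
qed

end

subsection \<open>Derivations in terms of a basis\<close>

locale free_algebra_basis = free_algebra P sV
  for P :: "('r::comm_ring_1, 'o::ab_group_add) operad_data"
    and sV :: "'r \<Rightarrow> 'v::ab_group_add \<Rightarrow> 'v" +
  fixes X :: "'v set"
  assumes finite_X: "finite X"
    and independent_X: "\<not> module.dependent sV X"
    and span_X: "module.span sV X = UNIV"
begin

abbreviation coord :: "'v \<Rightarrow> 'v \<Rightarrow> 'r" where "coord \<equiv> module.representation sV X"

lemma coord_add: "coord (v + w) x = coord v x + coord w x"
  using module.representation_add[OF V_module independent_X, of w v] span_X by simp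

lemma coord_scale: "coord (sV c v) x = c * coord v x"
  using module.representation_scale[OF V_module independent_X, of v c] span_X by simp

lemma coord_basis: "x \<in> X \<Longrightarrow> coord x y = (if y = x then 1 else 0)"
  using module.representation_basis[OF V_module independent_X, of x] by simp

lemma sum_coord: "(\<Sum>x\<in>X. sV (coord v x) x) = v"
  using module.sum_representation_eq[OF V_module independent_X, of v X] span_X finite_X by simp

text \<open>
  The linear map with the values \<open>g x\<close> for \<open>x \<in> X\<close>. Because coordinates are unique, it is strictly
  linear with values in formal combinations, before any relations are imposed.
\<close>

definition ext :: "('v \<Rightarrow> (('o \<times> 'v list) \<Rightarrow>\<^sub>0 'r)) \<Rightarrow> 'v \<Rightarrow> (('o \<times> 'v list) \<Rightarrow>\<^sub>0 'r)" where
  "ext g v = (\<Sum>x\<in>X. free_scale (coord v x) (g x))"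

lemma ext_basis: "x \<in> X \<Longrightarrow> ext g x = g x"
proof -
  assume x: "x \<in> X"
  have "ext g x = (\<Sum>y\<in>X. if y = x then g y else 0)"
    unfolding ext_def by (intro sum.cong) (auto simp: coord_basis[OF x])
  then show ?thesis using x finite_X by simp
qed

lemma ext_in_subspace: "free.subspace S \<Longrightarrow> (\<And>x. x \<in> X \<Longrightarrow> g x \<in> S) \<Longrightarrow> ext g v \<in> S"
  unfolding ext_def by (intro free.subspace_sum free.subspace_scale)

lemma linear_into_ext:
  assumes "\<And>x. x \<in> X \<Longrightarrow> g x \<in> formals"
  shows "linear_into (ext g)"
  unfolding linear_into_def
proof (intro conjI allI)
  have "ext g v \<in> formals" for v by (intro ext_in_subspace[OF subspace_keys] assms)
  then show "range (ext g) \<subseteq> formals" by blast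
qed (simp_all add: ext_def coord_add coord_scale free.scale_left_distrib sum.distrib free.scale_sum_right)

lemma \<iota>_zero: "\<iota> 0 \<approx> 0"
  using \<iota>_scale[of 0 0] module.scale_zero_left[OF V_module] by simp

lemma \<iota>_sum: "finite A \<Longrightarrow> \<iota> (sum h A) \<approx> (\<Sum>a\<in>A. \<iota> (h a))"
proof (induction A rule: finite_induct)
  case (insert a A)
  have "\<iota> (h a + sum h A) \<approx> \<iota> (h a) + (\<Sum>a\<in>A. \<iota> (h a))"
    by (rule cong_trans[OF \<iota>_add cong_add[OF cong_refl insert.IH]])
  then show ?case using insert by simp
qed (use \<iota>_zero in simp)

lemma \<iota>_expand: "\<iota> v \<approx> ext \<iota> v"
proof -
  have "\<iota> (\<Sum>x\<in>X. sV (coord v x) x) \<approx> (\<Sum>x\<in>X. free_scale (coord v x) (\<iota> x))"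
    by (rule cong_trans[OF \<iota>_sum[OF finite_X] cong_sum[OF \<iota>_scale]])
  then show ?thesis unfolding sum_coord ext_def .
qed

definition \<delta> :: "('v \<Rightarrow> (('o \<times> 'v list) \<Rightarrow>\<^sub>0 'r)) \<Rightarrow> ('r, 'o, 'v) fa_map" where
  "\<delta> g = der_of (ext g)"

lemma Der_ext_basis:
  assumes d: "d \<in> Der P sV" and e: "e \<in> Der P sV"
    and agree: "\<And>x. x \<in> X \<Longrightarrow> d (cl (\<iota> x)) = e (cl (\<iota> x))"
  shows "d = e"
proof (rule Der_ext[OF d e])
  fix v
  have "ext \<iota> v \<in> {f \<in> formals. d (cl f) = e (cl f)}"
    using agree \<iota>s_closed by (intro ext_in_subspace[OF subspace_agree[OF d e]]) simp
  then show "d (fa_incl P sV v) = e (fa_incl P sV v)"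
    using coset_eqI[OF \<iota>_expand[of v]] by (simp add: fa_incl_eq)
qed

lemma \<delta>_Der: "(\<And>x. x \<in> X \<Longrightarrow> g x \<in> formals) \<Longrightarrow> \<delta> g \<in> Der P sV"
  unfolding \<delta>_def by (intro der_of_Der linear_into_ext)

lemma \<delta>_incl: "(\<And>x. x \<in> X \<Longrightarrow> g x \<in> formals) \<Longrightarrow> \<delta> g (fa_incl P sV v) = cl (ext g v)"
  unfolding \<delta>_def by (intro der_of_incl linear_into_ext)

text \<open>
  So all derivations are of the form \<open>\<delta> g\<close>, and identities between them can be checked on \<open>X\<close>.
\<close>

lemma Der_eq_\<delta>:
  assumes d: "d \<in> Der P sV" and g: "\<And>x. x \<in> X \<Longrightarrow> g x \<in> formals"
    and eq: "\<And>x. x \<in> X \<Longrightarrow> d (fa_incl P sV x) = cl (g x)"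
  shows "d = \<delta> g"
proof (rule Der_ext_basis[OF d \<delta>_Der[of g, OF g]])
  fix x assume "x \<in> X"
  then show "d (cl (\<iota> x)) = \<delta> g (cl (\<iota> x))"
    using eq[of x] \<delta>_incl[of g x, OF g] by (simp add: fa_incl_eq ext_basis)
qed

lemma \<delta>_cong:
  assumes "\<And>x. x \<in> X \<Longrightarrow> g x \<in> formals" "\<And>x. x \<in> X \<Longrightarrow> h x \<in> formals" "\<And>x. x \<in> X \<Longrightarrow> g x \<approx> h x"
  shows "\<delta> g = \<delta> h"
proof (rule Der_eq_\<delta>[OF \<delta>_Der])
  show "\<delta> g (fa_incl P sV x) = cl (h x)" if "x \<in> X" for x
    using \<delta>_incl[of g x, OF assms(1)] assms(3) that by (simp add: ext_basis coset_eq_iff)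
qed (use assms in auto)

lemma \<delta>_coset: "(\<And>x. x \<in> X \<Longrightarrow> g x \<in> formals) \<Longrightarrow> f \<in> formals \<Longrightarrow> \<delta> g (cl f) = cl (der_formal (ext g) f)"
  unfolding \<delta>_def by (intro der_of_coset linear_into_ext)

lemma ext_add_fun: "ext (\<lambda>x. g x + h x) v = ext g v + ext h v"
  by (simp add: ext_def free.scale_right_distrib sum.distrib)

lemma ext_scale_fun: "ext (\<lambda>x. free_scale c (g x)) v = free_scale c (ext g v)"
  by (simp add: ext_def free.scale_sum_right mult.commute)

lemma der_symbol_add: "der_symbol (\<lambda>v. \<gamma> v + \<gamma>' v) x = der_symbol \<gamma> x + der_symbol \<gamma>' x"
  by (simp add: der_symbol_def formal_op_update_add sum.distrib)

lemma der_symbol_scale: "der_symbol (\<lambda>v. free_scale c (\<gamma> v)) x = free_scale c (der_symbol \<gamma> x)"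
  by (simp add: der_symbol_def formal_op_update_scale free.scale_sum_right)

lemma der_symbol_zero: "der_symbol (\<lambda>v. 0) x = 0"
  by (simp add: der_symbol_def formal_op_update_zero)

lemma \<delta>_extensional: "\<delta> g \<in> extensional (fa_carrier P sV)"
  by (simp add: \<delta>_def der_of_def)

lemma der_add_\<delta>:
  assumes g: "\<And>x. x \<in> X \<Longrightarrow> g x \<in> formals" and h: "\<And>x. x \<in> X \<Longrightarrow> h x \<in> formals"
  shows "der_add P sV (\<delta> g) (\<delta> h) = \<delta> (\<lambda>x. g x + h x)"
proof (rule extensionalityI[OF _ \<delta>_extensional])
  fix Y assume Y: "Y \<in> fa_carrier P sV"
  then obtain f where f: "Y = cl f" "f \<in> formals" unfolding fa_carrier_eq by blast
  have gh: "g x + h x \<in> formals" if "x \<in> X" for x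
    using free.subspace_add[OF subspace_keys g[OF that] h[OF that]] .
  show "der_add P sV (\<delta> g) (\<delta> h) Y = \<delta> (\<lambda>x. g x + h x) Y"
    using Y unfolding der_add_def f(1)
    by (simp add: \<delta>_coset[of g, OF g f(2)] \<delta>_coset[of h, OF h f(2)] \<delta>_coset[of "\<lambda>x. g x + h x", OF gh f(2)] fa_add_coset
        der_formal_def ext_add_fun[abs_def] der_symbol_add[abs_def] lin_add_fun)
qed (simp add: der_add_def)

lemma der_scale_\<delta>:
  assumes g: "\<And>x. x \<in> X \<Longrightarrow> g x \<in> formals"
  shows "der_scale P sV c (\<delta> g) = \<delta> (\<lambda>x. free_scale c (g x))"
proof (rule extensionalityI[OF _ \<delta>_extensional])
  fix Y assume Y: "Y \<in> fa_carrier P sV"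
  then obtain f where f: "Y = cl f" "f \<in> formals" unfolding fa_carrier_eq by blast
  have gc: "free_scale c (g x) \<in> formals" if "x \<in> X" for x
    using free.subspace_scale[OF subspace_keys g[OF that]] .
  show "der_scale P sV c (\<delta> g) Y = \<delta> (\<lambda>x. free_scale c (g x)) Y"
    using Y unfolding der_scale_def f(1)
    by (simp add: \<delta>_coset[of g, OF g f(2)] \<delta>_coset[of "\<lambda>x. free_scale c (g x)", OF gc f(2)] fa_scale_coset
        der_formal_def ext_scale_fun[abs_def] der_symbol_scale[abs_def] lin_scale_fun)
qed (simp add: der_scale_def)

lemma der_zero_\<delta>: "der_zero P sV = \<delta> (\<lambda>x. 0)"
proof (rule extensionalityI[OF _ \<delta>_extensional])
  fix Y assume Y: "Y \<in> fa_carrier P sV"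
  then obtain f where f: "Y = cl f" "f \<in> formals" unfolding fa_carrier_eq by blast
  show "der_zero P sV Y = \<delta> (\<lambda>x. 0) Y"
    using Y unfolding der_zero_def f(1)
    by (simp add: \<delta>_coset[of "\<lambda>x. 0", OF _ f(2)] fa_zero_def der_formal_def ext_def[abs_def] der_symbol_zero[abs_def])
qed (simp add: der_zero_def)

lemma der_formal_ext:
  "der_formal \<gamma> (ext g v) = ext (\<lambda>x. der_formal \<gamma> (g x)) v"
  by (simp add: ext_def der_formal_def lin_sum lin_scale)

text \<open>
  The preLie product applies the second derivation to the values of the first. The description in
  the definition of the product singles out this derivation by \<open>Der_ext\<close>.
\<close>

lemma der_prelie_\<delta>:
  assumes g: "\<And>x. x \<in> X \<Longrightarrow> g x \<in> formals" and h: "\<And>x. x \<in> X \<Longrightarrow> h x \<in> formals"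
  shows "der_prelie P sV (\<delta> g) (\<delta> h) = \<delta> (\<lambda>x. der_formal (ext h) (g x))"
proof -
  note eh = linear_intoD(1)[OF linear_into_ext[of h, OF h]]
  have closed: "der_formal (ext h) (g x) \<in> formals" if "x \<in> X" for x
    by (intro der_formal_closed eh g that)
  have "ext g v \<in> formals" for v by (intro ext_in_subspace[OF subspace_keys] g)
  then have eq: "\<delta> (\<lambda>x. der_formal (ext h) (g x)) (fa_incl P sV v) = \<delta> h (\<delta> g (fa_incl P sV v))" for v
    by (simp only: \<delta>_incl[of g, OF g] \<delta>_incl[of "\<lambda>x. der_formal (ext h) (g x)", OF closed] \<delta>_coset[of h, OF h] der_formal_ext)
  show ?thesis
    unfolding der_prelie_def
  proof (rule the_equality)
    fix c assume c: "c \<in> Der P sV \<and> (\<forall>v. c (fa_incl P sV v) = \<delta> h (\<delta> g (fa_incl P sV v)))"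
    show "c = \<delta> (\<lambda>x. der_formal (ext h) (g x))"
      by (rule Der_ext[OF _ \<delta>_Der[of "\<lambda>x. der_formal (ext h) (g x)", OF closed]]) (use c eq in auto)
  qed (use \<delta>_Der[of "\<lambda>x. der_formal (ext h) (g x)", OF closed] eq in auto)
qed

end

section \<open>Decomposition of the operations of a binary operad\<close>

lemma leaf_list_relabel [simp]: "leaf_list (relabel f t) = map f (leaf_list t)"
  by (induction t) (auto simp: relabel_def)

lemma tree_gens_relabel [simp]: "tree_gens (relabel f t) = tree_gens t"
  by (simp add: relabel_def gtree.set_map)

lemma relabel_relabel: "relabel f (relabel g t) = relabel (f \<circ> g) t"
  by (simp add: relabel_def gtree.map_comp)

lemma relabel_ident: "(\<And>i. i \<in> set (leaf_list t) \<Longrightarrow> f i = i) \<Longrightarrow> relabel f t = t"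
  by (induction t) (auto simp: relabel_def)

lemma leaf_list_nonempty: "leaf_list t \<noteq> []"
  by (induction t) auto

lemma free_operad_simps:
  "ops (free_binary_operad B) n = {f. Poly_Mapping.keys f \<subseteq> op_trees B n}"
  "op_scale (free_binary_operad B) = free_scale"
  "op_act (free_binary_operad B) n \<sigma> (sg t) = sg (relabel (inv \<sigma>) t)"
  "op_unit (free_binary_operad B) = sg (Leaf 0)"
  "op_comp (free_binary_operad B) [p, q] (sg t) [sg s, sg u] = sg (graft [p, q] t [s, u])"
  by (simp_all add: free_binary_operad_def set_Cons_def)

text \<open>
  Reading the leaves from left to right gives a permutation. Undoing it numbers the leaves in
  planar order, at the price of the symmetric group action.
\<close>

lemma op_tree_planar:
  assumes t: "t \<in> op_trees B n"
  obtains \<sigma> t' where "\<sigma> permutes {..<n}" "relabel (inv \<sigma>) t' = t" "t' \<in> op_trees B n" "leaf_list t' = [0..<n]"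
proof -
  let ?l = "leaf_list t"
  have l: "distinct ?l" "set ?l = {..<n}" "tree_gens t \<subseteq> B" using t by (auto simp: op_trees_def)
  then have len: "length ?l = n" using distinct_card[of ?l] by simp
  define \<pi> where "\<pi> = perm_of_list ?l"
  have \<pi>: "\<pi> permutes {..<n}" using perm_of_list_permutes[of ?l] l len by (simp add: \<pi>_def)
  have "?l = map \<pi> [0..<n]" using len by (intro nth_equalityI) (auto simp: \<pi>_def perm_of_list_def)
  then have "map (inv \<pi>) ?l = map (inv \<pi> \<circ> \<pi>) [0..<n]" by simp
  then have leaves: "leaf_list (relabel (inv \<pi>) t) = [0..<n]"
    using permutes_inv_o(2)[OF \<pi>] by simp
  show ?thesis
  proof (rule that[of "inv \<pi>" "relabel (inv \<pi>) t"])
    show "inv \<pi> permutes {..<n}" by (rule permutes_inv[OF \<pi>])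
    show "relabel (inv (inv \<pi>)) (relabel (inv \<pi>) t) = t"
      using permutes_inv_o(1)[OF \<pi>] permutes_inv_inv[OF \<pi>] by (simp add: relabel_relabel relabel_ident)
    show "relabel (inv \<pi>) t \<in> op_trees B n"
      unfolding op_trees_def mem_Collect_eq leaves using l(3) by auto
  qed (rule leaves)
qed

text \<open>
  When the leaves are numbered in planar order, the two subtrees at the root use consecutive
  blocks of numbers, as grafting requires; shifting the numbers of the right one down makes it a basis
  element.
\<close>

lemma planar_tree_graft:
  assumes t: "Node b s u \<in> op_trees B n" and leaves: "leaf_list (Node b s u) = [0..<n]"
  obtains p q u' where "p \<ge> 1" "q \<ge> 1" "p + q = n" "s \<in> op_trees B p" "u' \<in> op_trees B q"
    "Node b (Leaf 0) (Leaf 1) \<in> op_trees B 2"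
    "graft [p, q] (Node b (Leaf 0) (Leaf 1)) [s, u'] = Node b s u"
proof -
  let ?p = "length (leaf_list s)" and ?q = "length (leaf_list u)"
  let ?u = "relabel (\<lambda>j. j - ?p) u"
  have n: "?p + ?q = n" using arg_cong[OF leaves, of length] by simp
  have "leaf_list s = take ?p (leaf_list s @ leaf_list u)" by simp
  also have "\<dots> = [0..<?p]" using leaves n by simp
  finally have s: "leaf_list s = [0..<?p]" .
  have "leaf_list u = drop ?p (leaf_list s @ leaf_list u)" by simp
  also have "\<dots> = [?p..<n]" using leaves n by simp
  finally have u: "leaf_list u = [?p..<n]" .
  have u': "leaf_list ?u = [0..<?q]"
    using n by (intro nth_equalityI) (simp_all add: u)
  have "relabel (\<lambda>j. ?p + j) ?u = u"
    by (auto simp: relabel_relabel u intro!: relabel_ident)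
  moreover have "relabel ((+) 0) s = s" by (rule relabel_ident) simp
  ultimately have "graft [?p, ?q] (Node b (Leaf 0) (Leaf 1)) [s, ?u] = Node b s u"
    by (simp add: graft_def)
  moreover have "s \<in> op_trees B ?p" "?u \<in> op_trees B ?q" "Node b (Leaf 0) (Leaf 1) \<in> op_trees B 2"
    using t arg_cong[OF s, of set] unfolding op_trees_def mem_Collect_eq u'
    by (auto simp: atLeast0LessThan)
  moreover have "?p \<ge> 1" "?q \<ge> 1" using leaf_list_nonempty[of s] leaf_list_nonempty[of u] by (simp_all add: Suc_le_eq)
  ultimately show ?thesis using that n by blast
qed

locale binary_free_algebra = free_algebra P sV + \<phi>: operad_hom "free_binary_operad B" P \<phi>
  for P :: "('r::comm_ring_1, 'o::ab_group_add) operad_data"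
    and sV :: "'r \<Rightarrow> 'v::ab_group_add \<Rightarrow> 'v"
    and B :: "'b set"
    and \<phi> :: "nat \<Rightarrow> (('b, nat) gtree \<Rightarrow>\<^sub>0 'r) \<Rightarrow> 'o" +
  assumes \<phi>_surj: "\<phi> n ` ops (free_binary_operad B) n = ops P n"
begin

lemma \<phi>_tree: "t \<in> op_trees B n \<Longrightarrow> \<phi> n (sg t) \<in> ops P n"
  using \<phi>.hom_closed[of "sg t" n] by (simp add: free_operad_simps)

text \<open>
  Trees span the free operad and \<open>\<phi>\<close> is onto, so that the images of trees span the operad; the
  operation enters a symbol linearly modulo the relations.
\<close>

lemma graded_by_trees:
  assumes S: "free.subspace S" and rel: "relmod P sV \<subseteq> S"
    and trees: "\<And>t vs. t \<in> op_trees B n \<Longrightarrow> length vs = n \<Longrightarrow> sg (\<phi> n (sg t), vs) \<in> S"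
  shows "graded n \<subseteq> S"
proof
  fix f assume f: "f \<in> graded n"
  have S_cong: "h \<in> S" if "h \<approx> k" "k \<in> S" for h k
    using free.subspace_add[OF S, of "h - k" k] rel that by auto
  show "f \<in> S"
  proof (rule free_subspace_induct[OF S])
    fix x assume "x \<in> Poly_Mapping.keys f"
    then obtain \<mu> vs where x: "x = (\<mu>, vs)" and vs: "length vs = n" and \<mu>: "\<mu> \<in> ops P n"
      using f by (auto simp: sym_tensors_def)
    let ?F = "{F. Poly_Mapping.keys F \<subseteq> op_trees B n}"
    obtain F where F: "F \<in> ?F" "\<mu> = \<phi> n F" using \<mu> \<phi>_surj[of n] by (auto simp: free_operad_simps)
    have add: "sg (\<phi> n (G + H), vs) \<in> S" "G + H \<in> ?F"
      if "G \<in> ?F" "H \<in> ?F" "sg (\<phi> n G, vs) \<in> S" "sg (\<phi> n H, vs) \<in> S" for G H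
    proof -
      have "\<phi> n G \<in> ops P n" "\<phi> n H \<in> ops P n"
        using that \<phi>.hom_closed[of _ n] by (simp_all add: free_operad_simps)
      then have "sg (\<phi> n G + \<phi> n H, vs) \<in> S"
        using vs that by (intro S_cong[OF cong_op_add] free.subspace_add[OF S]) auto
      then show "sg (\<phi> n (G + H), vs) \<in> S"
        using \<phi>.hom_add[of G n H] that by (simp add: free_operad_simps)
      show "G + H \<in> ?F" by (rule free.subspace_add[OF subspace_keys that(1,2)])
    qed
    \<comment> \<open>The alternative \<open>c = 0\<close> gives the zero combination without an element to start from.\<close>
    have scale: "sg (\<phi> n (free_scale c G), vs) \<in> S" "free_scale c G \<in> ?F"
      if "G \<in> ?F" "c = 0 \<or> sg (\<phi> n G, vs) \<in> S" for c G
    proof -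
      have "\<phi> n G \<in> ops P n"
        using that \<phi>.hom_closed[of _ n] by (simp add: free_operad_simps)
      moreover have "Poly_Mapping.single (\<phi> n G, vs) c \<in> S"
        using that(2) free.subspace_0[OF S] free.subspace_scale[OF S, of "sg (\<phi> n G, vs)" c] by auto
      ultimately have "sg (op_scale P c (\<phi> n G), vs) \<in> S"
        using vs by (intro S_cong[OF cong_op_scale]) auto
      then show "sg (\<phi> n (free_scale c G), vs) \<in> S"
        using \<phi>.hom_scale[of G n c] that by (simp add: free_operad_simps)
      show "free_scale c G \<in> ?F" by (rule free.subspace_scale[OF subspace_keys that(1)])
    qed
    have "free.subspace {G \<in> ?F. sg (\<phi> n G, vs) \<in> S}"
      unfolding free.subspace_def
    proof (intro conjI ballI allI)
      show "0 \<in> {G \<in> ?F. sg (\<phi> n G, vs) \<in> S}" using scale[of 0 0] by simp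
      show "G + H \<in> {G \<in> ?F. sg (\<phi> n G, vs) \<in> S}"
        if "G \<in> {G \<in> ?F. sg (\<phi> n G, vs) \<in> S}" "H \<in> {G \<in> ?F. sg (\<phi> n G, vs) \<in> S}" for G H
        using that add[of G H] by (simp only: mem_Collect_eq)
      show "free_scale c G \<in> {G \<in> ?F. sg (\<phi> n G, vs) \<in> S}"
        if "G \<in> {G \<in> ?F. sg (\<phi> n G, vs) \<in> S}" for c G
        using that scale[of G c] by simp
    qed
    then have "F \<in> {G \<in> ?F. sg (\<phi> n G, vs) \<in> S}"
      by (rule free_subspace_induct) (use F(1) trees vs in auto)
    then show "sg x \<in> S" by (simp add: x F(2))
  qed
qed

text \<open>
  The symmetry relation permits to renumber the leaves in planar order if the vectors are permuted
  accordingly. The tree is then a grafting onto its root vertex, and the vectors split into those of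
  the two subtrees.
\<close>

lemma tree_decompose:
  assumes n: "n \<ge> 2" and t: "t \<in> op_trees B n" and vs: "length vs = n"
  obtains \<beta> p q f g where "\<beta> \<in> ops P 2" "p \<ge> 1" "q \<ge> 1" "p + q = n" "f \<in> graded p" "g \<in> graded q"
    "sg (\<phi> n (sg t), vs) \<approx> formal_op P \<beta> [f, g]"
proof -
  obtain \<sigma> t' where \<sigma>: "\<sigma> permutes {..<n}" and tt': "relabel (inv \<sigma>) t' = t"
    and t': "t' \<in> op_trees B n" "leaf_list t' = [0..<n]"
    by (rule op_tree_planar[OF t])
  let ?ws = "permute_list (inv \<sigma>) vs"
  have ws: "length ?ws = n" using vs by simp
  have "permute_list \<sigma> ?ws = permute_list (inv \<sigma> \<circ> \<sigma>) vs"
    using \<sigma> vs by (simp add: permute_list_compose)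
  then have perm: "permute_list \<sigma> ?ws = vs" using permutes_inv_o(2)[OF \<sigma>] by simp
  have "\<phi> n (sg t) = op_act P n \<sigma> (\<phi> n (sg t'))"
    using \<phi>.hom_act[OF \<sigma>, of "sg t'"] t'(1) by (simp add: free_operad_simps tt')
  then have cong: "sg (\<phi> n (sg t), vs) \<approx> sg (\<phi> n (sg t'), ?ws)"
    using cong_symm[of "\<phi> n (sg t')" ?ws \<sigma>] \<phi>_tree[OF t'(1)] \<sigma> by (simp add: ws vs perm)
  have "length (leaf_list t') \<ge> 2" using t'(2) n by simp
  then obtain b s u where node: "t' = Node b s u" by (cases t') auto
  obtain p q u' where pq: "p \<ge> 1" "q \<ge> 1" "p + q = n" and s: "s \<in> op_trees B p" and u': "u' \<in> op_trees B q"
    and b: "Node b (Leaf 0) (Leaf 1) \<in> op_trees B 2"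
    and graft: "graft [p, q] (Node b (Leaf 0) (Leaf 1)) [s, u'] = Node b s u"
    using planar_tree_graft[of b s u B n] t' unfolding node by metis
  let ?\<beta> = "\<phi> 2 (sg (Node b (Leaf 0) (Leaf 1)))"
  have "\<phi> n (sg t') = op_comp P [p, q] ?\<beta> [\<phi> p (sg s), \<phi> q (sg u')]"
    using \<phi>.hom_comp[of "sg (Node b (Leaf 0) (Leaf 1))" "[p, q]" "[sg s, sg u']"] b s u' pq(3)
    by (simp add: free_operad_simps node graft[unfolded One_nat_def] numeral_2_eq_2)
  moreover have "length (take p ?ws) = p" "length (drop p ?ws) = q" using ws pq(3) by auto
  ultimately have "(\<phi> n (sg t'), ?ws) =
      tcomp P ?\<beta> [(\<phi> p (sg s), take p ?ws), (\<phi> q (sg u'), drop p ?ws)]"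
    by (simp add: tcomp_def del: length_take length_drop)
  then have "sg (\<phi> n (sg t'), ?ws) =
      formal_op P ?\<beta> [sg (\<phi> p (sg s), take p ?ws), sg (\<phi> q (sg u'), drop p ?ws)]"
    by (simp add: formal_op_mlin)
  moreover have "sg (\<phi> p (sg s), take p ?ws) \<in> graded p" "sg (\<phi> q (sg u'), drop p ?ws) \<in> graded q"
    using \<phi>_tree[OF s] \<phi>_tree[OF u'] ws pq(3) by (auto simp: sym_tensors_def)
  ultimately show ?thesis using that[OF \<phi>_tree[OF b] pq] cong by metis
qed

lemma graded_decompose:
  assumes S: "free.subspace S" and rel: "relmod P sV \<subseteq> S" and n: "n \<ge> 2"
    and prods: "\<And>\<beta> p q f g. \<beta> \<in> ops P 2 \<Longrightarrow> p \<ge> 1 \<Longrightarrow> q \<ge> 1 \<Longrightarrow> p + q = n \<Longrightarrow>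
      f \<in> graded p \<Longrightarrow> g \<in> graded q \<Longrightarrow> formal_op P \<beta> [f, g] \<in> S"
  shows "graded n \<subseteq> S"
proof (rule graded_by_trees[OF S rel])
  fix t vs assume "t \<in> op_trees B n" "length (vs :: 'v list) = n"
  from tree_decompose[OF n this] obtain \<beta> p q f g where
    "\<beta> \<in> ops P 2" "p \<ge> 1" "q \<ge> 1" "p + q = n" "f \<in> graded p" "g \<in> graded q"
    and c: "sg (\<phi> n (sg t), vs) \<approx> formal_op P \<beta> [f, g]" .
  then have "formal_op P \<beta> [f, g] \<in> S" by (intro prods)
  with c rel show "sg (\<phi> n (sg t), vs) \<in> S"
    using free.subspace_add[OF S, of "sg (\<phi> n (sg t), vs) - formal_op P \<beta> [f, g]" "formal_op P \<beta> [f, g]"] by auto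
qed

lemma op_trees_1: "t \<in> op_trees B 1 \<Longrightarrow> t = Leaf 0"
proof (cases t)
  case (Node b s u)
  assume "t \<in> op_trees B 1"
  then have "card (set (leaf_list t)) = 1" "distinct (leaf_list t)" by (auto simp: op_trees_def)
  then have "length (leaf_list s) + length (leaf_list u) = 1" using Node by (metis distinct_card leaf_list.simps(2) length_append)
  then show ?thesis using leaf_list_nonempty[of s] leaf_list_nonempty[of u] by (auto simp: add_is_1)
qed (auto simp: op_trees_def)

text \<open>
  The only tree with one leaf is the trivial one, which \<open>\<phi>\<close> sends to the unit.
\<close>

lemma graded_1:
  assumes S: "free.subspace S" and rel: "relmod P sV \<subseteq> S" and \<iota>: "\<And>v. \<iota> v \<in> S"
  shows "graded 1 \<subseteq> S"
proof (rule graded_by_trees[OF S rel])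
  fix t vs assume t: "t \<in> op_trees B 1" and "length (vs :: 'v list) = 1"
  then obtain v where "vs = [v]" by (auto simp: length_Suc_conv)
  then show "sg (\<phi> 1 (sg t), vs) \<in> S"
    using op_trees_1[OF t] \<phi>.hom_unit \<iota>[of v] by (simp add: free_operad_simps \<iota>s_def)
qed

end

section \<open>The degree one part generates\<close>

locale binary_free_algebra_basis = free_algebra_basis P sV X + binary_free_algebra P sV B \<phi>
  for P :: "('r::comm_ring_1, 'o::ab_group_add) operad_data"
    and sV :: "'r \<Rightarrow> 'v::ab_group_add \<Rightarrow> 'v"
    and X :: "'v set"
    and B :: "'b set"
    and \<phi> :: "nat \<Rightarrow> (('b, nat) gtree \<Rightarrow>\<^sub>0 'r) \<Rightarrow> 'o"

context free_algebra_basis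
begin

text \<open>
  \<open>E x f\<close> is the derivation \<open>[x \<mapsto> f]\<close> that sends the basis element \<open>x\<close> to \<open>f\<close> and the others
  to \<open>0\<close>.
\<close>

definition point_map :: "'v \<Rightarrow> (('o \<times> 'v list) \<Rightarrow>\<^sub>0 'r) \<Rightarrow> 'v \<Rightarrow> (('o \<times> 'v list) \<Rightarrow>\<^sub>0 'r)" where
  "point_map x f = (\<lambda>y. if y = x then f else 0)"

abbreviation E :: "'v \<Rightarrow> (('o \<times> 'v list) \<Rightarrow>\<^sub>0 'r) \<Rightarrow> ('r, 'o, 'v) fa_map" where
  "E x f \<equiv> \<delta> (point_map x f)"

lemma point_map_closed: "f \<in> formals \<Longrightarrow> point_map x f y \<in> formals"
  by (simp add: point_map_def)

lemma Der_degI: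
  assumes "\<And>x. x \<in> X \<Longrightarrow> g x \<in> graded (k + 1)"
  shows "\<delta> g \<in> Der_deg P sV k"
proof -
  have g: "g x \<in> formals" if "x \<in> X" for x using assms[OF that] graded_formals by blast
  have "ext g v \<in> graded (k + 1)" for v by (rule ext_in_subspace[OF subspace_keys assms])
  then show ?thesis
    unfolding Der_deg_def fa_graded_def using \<delta>_Der[of g, OF g] \<delta>_incl[of g, OF g] by blast
qed

lemma Der_degE:
  assumes "d \<in> Der_deg P sV k"
  obtains g where "\<And>x. g x \<in> graded (k + 1)" "d = \<delta> g"
proof -
  have "\<exists>f\<in>graded (k + 1). d (fa_incl P sV x) = cl f" for x
    using assms unfolding Der_deg_def fa_graded_def by blast
  then obtain g where g: "\<And>x. g x \<in> graded (k + 1)" "\<And>x. d (fa_incl P sV x) = cl (g x)" by metis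
  moreover have "g x \<in> formals" for x using g(1) graded_formals by blast
  ultimately show ?thesis using that Der_eq_\<delta>[of d g] assms unfolding Der_deg_def by blast
qed

text \<open>
  With the next lemma, the \<open>f\<close> with \<open>[x \<mapsto> f]\<close> in a given submodule form a submodule containing
  the relations. Hence it is enough to treat spanning sets of the free algebra.
\<close>

lemma subspace_E:
  assumes L: "der_submodule P sV L"
  shows "free.subspace {f \<in> formals. E x f \<in> L}" (is "free.subspace ?S")
  unfolding free.subspace_def
proof (intro conjI ballI allI)
  have "point_map x 0 = (\<lambda>x. 0)" by (auto simp: point_map_def)
  then show "0 \<in> ?S" using L by (simp add: der_submodule_def der_zero_\<delta>)
next
  fix f g assume fg: "f \<in> ?S" "g \<in> ?S"
  have "E x (f + g) = \<delta> (\<lambda>y. point_map x f y + point_map x g y)" by (rule arg_cong[of _ _ \<delta>]) (auto simp: point_map_def)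
  also have "\<dots> = der_add P sV (E x f) (E x g)"
    using fg by (intro der_add_\<delta>[symmetric] point_map_closed) auto
  also have "\<dots> \<in> L" using L fg by (simp add: der_submodule_def)
  finally show "f + g \<in> ?S" using fg free.subspace_add[OF subspace_keys, of f "symbols P" g] by simp
next
  fix c f assume f: "f \<in> ?S"
  have "E x (free_scale c f) = \<delta> (\<lambda>y. free_scale c (point_map x f y))"
    by (rule arg_cong[of _ _ \<delta>]) (auto simp: point_map_def)
  also have "\<dots> = der_scale P sV c (E x f)"
    using f by (intro der_scale_\<delta>[symmetric] point_map_closed) auto
  also have "\<dots> \<in> L" using L f by (simp add: der_submodule_def)
  finally show "free_scale c f \<in> ?S" using f free.subspace_scale[OF subspace_keys, of f "symbols P" c] by simp
qed

lemma relmod_E: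
  assumes L: "der_submodule P sV L"
  shows "relmod P sV \<subseteq> {f \<in> formals. E x f \<in> L}"
proof
  fix f assume f: "f \<in> relmod P sV"
  have f': "f \<in> formals" using relmod_keys[OF f] by simp
  have "E x f = \<delta> (\<lambda>x. 0)"
    by (rule \<delta>_cong) (use f f' point_map_closed[OF f'] in \<open>auto simp: point_map_def free.subspace_0[OF subspace_relmod]\<close>)
  then show "f \<in> {f \<in> formals. E x f \<in> L}"
    using L f' by (simp add: der_submodule_def der_zero_\<delta>)
qed

lemma \<delta>_in_submodule:
  assumes L: "der_submodule P sV L" and g: "\<And>x. x \<in> X \<Longrightarrow> g x \<in> formals" "\<And>x. x \<in> X \<Longrightarrow> E x (g x) \<in> L"
  shows "\<delta> g \<in> L"
proof -
  have "\<delta> (\<lambda>y. if y \<in> A then g y else 0) \<in> L" if "A \<subseteq> X" for A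
    using finite_subset[OF that finite_X] that
  proof (induction A rule: finite_induct)
    case empty
    then show ?case using L by (simp add: der_submodule_def der_zero_\<delta>)
  next
    case (insert a A)
    have "\<delta> (\<lambda>y. if y \<in> insert a A then g y else 0) = \<delta> (\<lambda>y. point_map a (g a) y + (if y \<in> A then g y else 0))"
      using insert.hyps by (intro arg_cong[of _ _ \<delta>]) (auto simp: point_map_def)
    also have "\<dots> = der_add P sV (E a (g a)) (\<delta> (\<lambda>y. if y \<in> A then g y else 0))"
      by (rule der_add_\<delta>[symmetric]) (use insert.prems g(1) in \<open>auto simp: point_map_def\<close>)
    also have "\<dots> \<in> L" using insert g(2) L by (simp add: der_submodule_def)
    finally show ?case .
  qed
  from this[of X] have "\<delta> (\<lambda>y. if y \<in> X then g y else 0) \<in> L" by simp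
  moreover have "\<delta> (\<lambda>y. if y \<in> X then g y else 0) = \<delta> g"
    by (rule \<delta>_cong) (use g in \<open>auto simp: free.subspace_0[OF subspace_relmod]\<close>)
  ultimately show ?thesis by simp
qed

text \<open>
  The derivation \<open>[y \<mapsto> h]\<close> on formal combinations; it replaces the occurrences of \<open>y\<close> by \<open>h\<close>
  one at a time.
\<close>

definition replace :: "'v \<Rightarrow> (('o \<times> 'v list) \<Rightarrow>\<^sub>0 'r) \<Rightarrow> (('o \<times> 'v list) \<Rightarrow>\<^sub>0 'r) \<Rightarrow> (('o \<times> 'v list) \<Rightarrow>\<^sub>0 'r)" where
  "replace y h = der_formal (ext (point_map y h))"

lemma range_ext_at: "h \<in> formals \<Longrightarrow> range (ext (point_map y h)) \<subseteq> formals"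
  by (intro linear_intoD(1) linear_into_ext point_map_closed)

lemma replace_\<iota>:
  assumes "h \<in> formals" "z \<in> X"
  shows "replace y h (\<iota> z) = (if z = y then h else 0)"
proof -
  have "ext (point_map y h) z = point_map y h z" by (rule ext_basis[OF assms(2)])
  then show ?thesis
    using der_formal_\<iota>[of "ext (point_map y h)" z] point_map_closed[OF assms(1), of y z]
    by (simp add: replace_def point_map_def)
qed

lemma replace_op2:
  assumes "h \<in> formals" "\<beta> \<in> ops P 2" "f \<in> formals" "g \<in> formals"
  shows "replace y h (formal_op P \<beta> [f, g]) =
    formal_op P \<beta> [replace y h f, g] + formal_op P \<beta> [f, replace y h g]"
  using der_formal_op[OF range_ext_at[OF assms(1)], of \<beta> "[f, g]" y] assms
  by (simp add: replace_def numeral_2_eq_2)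

lemma replace_graded:
  assumes "h \<in> graded (Suc k)" "f \<in> graded n"
  shows "replace y h f \<in> graded (n + k)"
  unfolding replace_def
proof (rule der_formal_graded[OF _ assms(2)])
  fix v show "ext (point_map y h) v \<in> graded (Suc k)"
    by (rule ext_in_subspace[OF subspace_keys]) (use assms(1) in \<open>simp add: point_map_def\<close>)
qed

lemma prelie_E:
  assumes "f \<in> formals" "h \<in> formals"
  shows "der_prelie P sV (E x f) (E y h) = E x (replace y h f)"
proof -
  have "der_prelie P sV (E x f) (E y h) = \<delta> (\<lambda>z. der_formal (ext (point_map y h)) (point_map x f z))"
    by (intro der_prelie_\<delta> point_map_closed assms)
  also have "\<dots> = E x (replace y h f)"
    by (rule arg_cong[of _ _ \<delta>]) (auto simp: point_map_def replace_def der_formal_def)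
  finally show ?thesis .
qed

lemma replace_formals:
  assumes "h \<in> formals" "f \<in> formals"
  shows "replace y h f \<in> formals"
  unfolding replace_def by (intro der_formal_closed range_ext_at assms)

lemma formal_op2_closed: "\<beta> \<in> ops P 2 \<Longrightarrow> f \<in> formals \<Longrightarrow> g \<in> formals \<Longrightarrow> formal_op P \<beta> [f, g] \<in> formals"
  using formal_op_closed[of \<beta> "[f, g]"] by (simp add: numeral_2_eq_2)

lemma subspace_slot:
  assumes S: "free.subspace S" and rel: "relmod P sV \<subseteq> S" and \<beta>: "\<beta> \<in> ops P (length fs)"
    and fs: "set fs \<subseteq> formals" and i: "i < length fs"
  shows "free.subspace {g. formal_op P \<beta> (fs[i := g]) \<in> S}"
    and "relmod P sV \<subseteq> {g. formal_op P \<beta> (fs[i := g]) \<in> S}"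
proof -
  show "free.subspace {g. formal_op P \<beta> (fs[i := g]) \<in> S}"
    using i free.subspace_0[OF S] free.subspace_add[OF S] free.subspace_scale[OF S]
    by (simp add: free.subspace_def formal_op_update_zero formal_op_update_add formal_op_update_scale)
  show "relmod P sV \<subseteq> {g. formal_op P \<beta> (fs[i := g]) \<in> S}"
  proof
    fix g assume "g \<in> relmod P sV"
    then have "formal_op P \<beta> (fs[i := g]) \<in> relmod P sV"
      using formal_op_slot_cong[OF \<beta> fs i, of g 0] i by (simp add: formal_op_update_zero)
    then show "g \<in> {g. formal_op P \<beta> (fs[i := g]) \<in> S}" using rel by blast
  qed
qed

end

context binary_free_algebra_basis
begin

context
  fixes L
  assumes L: "sub_prelie P sV L" and deg1: "Der_deg P sV 1 \<subseteq> L" and card_X: "card X \<noteq> 1"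
begin

lemma submodule_L: "der_submodule P sV L"
  using L by (simp add: sub_prelie_def)

lemma other_basis_element:
  assumes "z \<in> X" obtains y where "y \<in> X" "y \<noteq> z"
proof -
  have "X \<noteq> {z}" using card_X by auto
  then show ?thesis using assms that by blast
qed

lemma E_degree_1: "f \<in> graded 2 \<Longrightarrow> E x f \<in> L"
  using Der_degI[of "point_map x f" 1] deg1 by (auto simp: point_map_def numeral_2_eq_2)

lemma op_\<iota>_graded: "\<beta> \<in> ops P 2 \<Longrightarrow> formal_op P \<beta> [\<iota> y, \<iota> z] \<in> graded 2"
  using formal_op_graded[of \<beta> "[\<iota> y, \<iota> z]" "[1, 1]"] \<iota>_graded by (simp add: numeral_2_eq_2)

lemma prelie_E_in: "f \<in> formals \<Longrightarrow> h \<in> formals \<Longrightarrow> E x f \<in> L \<Longrightarrow> E y h \<in> L \<Longrightarrow> E x (replace y h f) \<in> L"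
  using L prelie_E[of f h x y] unfolding sub_prelie_def by metis

lemma op_zero:
  fixes f g :: "('o \<times> 'v list) \<Rightarrow>\<^sub>0 'r"
  shows "formal_op P \<beta> [0, g] = 0" "formal_op P \<beta> [f, 0] = 0"
  using formal_op_update_zero[of 0 "[f, g]" \<beta>] formal_op_update_zero[of 1 "[f, g]" \<beta>] by simp_all

text \<open>
  \<open>[x \<mapsto> \<beta>(f, z)] = [x \<mapsto> \<beta>(y, z)] \<lhd> [y \<mapsto> f]\<close> for \<open>y \<noteq> z\<close>. This is the only place where the
  rank matters: the replacement must not touch \<open>z\<close>.
\<close>

lemma op_\<iota>_in:
  assumes \<beta>: "\<beta> \<in> ops P 2" and f: "f \<in> formals" "\<And>y. y \<in> X \<Longrightarrow> E y f \<in> L" and z: "z \<in> X"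
  shows "E x (formal_op P \<beta> [f, \<iota> z]) \<in> L" "E x (formal_op P \<beta> [\<iota> z, f]) \<in> L"
proof -
  obtain y where y: "y \<in> X" "y \<noteq> z" using other_basis_element[OF z] .
  note closed = formal_op2_closed[OF \<beta> \<iota>_closed \<iota>_closed] f(1)
  note repl = replace_op2[OF f(1) \<beta> \<iota>_closed \<iota>_closed] replace_\<iota>[OF f(1)]
  show "E x (formal_op P \<beta> [f, \<iota> z]) \<in> L"
    using prelie_E_in[OF closed(1)[of y z] f(1) E_degree_1[OF op_\<iota>_graded[OF \<beta>]] f(2)[OF y(1)], of x] y z
    by (simp add: repl op_zero)
  show "E x (formal_op P \<beta> [\<iota> z, f]) \<in> L"
    using prelie_E_in[OF closed(1)[of z y] f(1) E_degree_1[OF op_\<iota>_graded[OF \<beta>]] f(2)[OF y(1)], of x] y z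
    by (simp add: repl op_zero)
qed

text \<open>
  Extension of the preceding lemma from basis elements to arity one, which they span modulo the
  relations.
\<close>

lemma op_graded_1_in:
  assumes \<beta>: "\<beta> \<in> ops P 2" and f: "f \<in> formals" "\<And>y. y \<in> X \<Longrightarrow> E y f \<in> L" and g: "g \<in> graded 1"
  shows "E x (formal_op P \<beta> [f, g]) \<in> L" "E x (formal_op P \<beta> [g, f]) \<in> L"
proof -
  let ?S = "{f \<in> formals. E x f \<in> L}"
  have \<beta>': "\<beta> \<in> ops P (length [f, f])" and ff: "set [f, f] \<subseteq> formals"
    using \<beta> f(1) by (simp_all add: numeral_2_eq_2)
  have *: "g \<in> {g. formal_op P \<beta> ([f, f][i := g]) \<in> ?S}"
    if i: "i < 2" and basis: "\<And>z. z \<in> X \<Longrightarrow> formal_op P \<beta> ([f, f][i := \<iota> z]) \<in> ?S" for i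
  proof -
    let ?T = "{g. formal_op P \<beta> ([f, f][i := g]) \<in> ?S}"
    have i': "i < length [f, f]" using i by simp
    note T = subspace_slot[OF subspace_E[OF submodule_L] relmod_E[OF submodule_L] \<beta>' ff i', of x]
    have "\<iota> v \<in> ?T" for v
    proof -
      have "ext \<iota> v \<in> ?T"
        by (rule ext_in_subspace[OF T(1)]) (use basis in blast)
      then have "(\<iota> v - ext \<iota> v) + ext \<iota> v \<in> ?T"
        by (intro free.subspace_add[OF T(1)]) (use \<iota>_expand[of v] T(2) in blast)
      then show ?thesis by (simp only: diff_add_cancel)
    qed
    then show ?thesis using graded_1[OF T] g by blast
  qed
  have cl: "formal_op P \<beta> [f, \<iota> z] \<in> formals" "formal_op P \<beta> [\<iota> z, f] \<in> formals" for z
    by (intro formal_op2_closed \<beta> f(1) \<iota>_closed)+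
  show "E x (formal_op P \<beta> [f, g]) \<in> L"
    using *[of 1] op_\<iota>_in(1)[OF \<beta> f] cl(1) by simp
  show "E x (formal_op P \<beta> [g, f]) \<in> L"
    using *[of 0] op_\<iota>_in(2)[OF \<beta> f] cl(2) by simp
qed

text \<open>
  The induction is over all basis elements at once, because the second factors of the preLie products
  belong to the basis element that is replaced.
\<close>

lemma E_generated: "n \<ge> 2 \<Longrightarrow> f \<in> graded n \<Longrightarrow> x \<in> X \<Longrightarrow> E x f \<in> L"
proof (induction n arbitrary: f x rule: less_induct)
  case (less n)
  show ?case
  proof (cases "n = 2")
    case True
    then show ?thesis using less.prems E_degree_1 by simp
  next
    case False
    then have n: "n \<ge> 3" using less.prems by simp
    let ?S = "{f \<in> formals. E x f \<in> L}"
    have "graded n \<subseteq> ?S"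
    proof (rule graded_decompose[OF subspace_E[OF submodule_L] relmod_E[OF submodule_L] less.prems(1)])
      fix \<beta> p q f g
      assume \<beta>: "\<beta> \<in> ops P 2" and pq: "p \<ge> 1" "q \<ge> 1" "p + q = n"
        and f: "f \<in> graded p" and g: "g \<in> graded q"
      have f': "f \<in> formals" and g': "g \<in> formals" using f g graded_formals by blast+
      have f_in: "E y f \<in> L" if "p \<ge> 2" "y \<in> X" for y
        using less.IH[of p f y] pq f that by simp
      have g_in: "E y g \<in> L" if "q \<ge> 2" "y \<in> X" for y
        using less.IH[of q g y] pq g that by simp
      have "E x (formal_op P \<beta> [f, g]) \<in> L"
      proof -
        consider "q = 1" | "p = 1" | "p \<ge> 2" "q \<ge> 2" using pq by linarith
        then show ?thesis
        proof cases
          case 1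
          then show ?thesis using op_graded_1_in(1)[OF \<beta> f' f_in] g pq n by simp
        next
          case 2
          then show ?thesis using op_graded_1_in(2)[OF \<beta> g' g_in] f pq n by simp
        next
          case 3
          \<comment> \<open>Any basis element can play the part of the auxiliary variable; \<open>x\<close> is one.\<close>
          let ?D = "replace x g"
          have Df: "?D f \<in> graded (n - 1)"
            using replace_graded[of g "q - 1" f p x] f g 3 pq by (simp add: algebra_simps)
          have Df': "?D f \<in> formals" by (rule replace_formals[OF g' f'])
          have "E x (formal_op P \<beta> [f, \<iota> x]) \<in> L"
            by (rule op_\<iota>_in(1)[OF \<beta> f' f_in less.prems(3)]) (use 3 in auto)
          from prelie_E_in[OF formal_op2_closed[OF \<beta> f' \<iota>_closed] g' this g_in[OF 3(2) less.prems(3)]]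
          have "E x (formal_op P \<beta> [?D f, \<iota> x] + formal_op P \<beta> [f, g]) \<in> L"
            using replace_op2[OF g' \<beta> f' \<iota>_closed, of x x] replace_\<iota>[OF g' less.prems(3), of x] by simp
          moreover have "E x (formal_op P \<beta> [?D f, \<iota> x]) \<in> L"
          proof (rule op_\<iota>_in(1)[OF \<beta> Df' _ less.prems(3)])
            show "E y (?D f) \<in> L" if "y \<in> X" for y
              using less.IH[of "n - 1" "?D f" y] n Df that by simp
          qed
          ultimately have "(formal_op P \<beta> [?D f, \<iota> x] + formal_op P \<beta> [f, g]) - formal_op P \<beta> [?D f, \<iota> x] \<in> ?S"
            using formal_op2_closed[OF \<beta> Df' \<iota>_closed, of x] formal_op2_closed[OF \<beta> f' g']
              free.subspace_add[OF subspace_keys, of "formal_op P \<beta> [?D f, \<iota> x]" "symbols P" "formal_op P \<beta> [f, g]"]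
            by (intro free.subspace_diff[OF subspace_E[OF submodule_L]]) auto
          then show ?thesis by simp
        qed
      qed
      then show "formal_op P \<beta> [f, g] \<in> ?S" using formal_op2_closed[OF \<beta> f' g'] by simp
    qed
    then show ?thesis using less.prems by blast
  qed
qed

lemma Der_deg_generated: "k \<ge> 1 \<Longrightarrow> Der_deg P sV k \<subseteq> L"
proof
  fix d assume k: "k \<ge> 1" and "d \<in> Der_deg P sV k"
  then obtain g where g: "\<And>x. g x \<in> graded (k + 1)" "d = \<delta> g" using Der_degE by blast
  have "g x \<in> formals" for x using g(1) graded_formals by blast
  moreover have "E x (g x) \<in> L" if "x \<in> X" for x
    using E_generated[OF _ g(1) that] k by simp
  ultimately show "d \<in> L" using \<delta>_in_submodule[OF submodule_L] g(2) by blast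
qed

end

end

section \<open>Positive derivations form a preLie algebra\<close>

context free_algebra_basis
begin

text \<open>
  A filtration in place of the grading, since positive derivations need not be homogeneous.
\<close>

definition arity_ge :: "nat \<Rightarrow> (('o \<times> 'v list) \<Rightarrow>\<^sub>0 'r) set" where
  "arity_ge m = {f. Poly_Mapping.keys f \<subseteq> {x \<in> symbols P. m \<le> length (snd x)}}"

lemma subspace_arity_ge: "free.subspace (arity_ge m)"
  unfolding arity_ge_def by (rule subspace_keys)

lemma arity_ge_formals: "arity_ge m \<subseteq> formals"
  by (auto simp: arity_ge_def)

text \<open>
  The arities of the arguments add up, and each of them contributes at least one.
\<close>

lemma formal_op_arity_ge:
  assumes \<mu>: "\<mu> \<in> ops P (length fs)" and fs: "\<And>f. f \<in> set fs \<Longrightarrow> f \<in> arity_ge 1"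
  shows "formal_op P \<mu> fs \<in> arity_ge (length fs)"
  unfolding formal_op_mlin
proof (rule mlin_in_subspace[OF subspace_arity_ge])
  fix xs assume xs: "list_all2 (\<lambda>x f. x \<in> Poly_Mapping.keys f) xs fs"
  have "set xs \<subseteq> {x \<in> symbols P. 1 \<le> length (snd x)}"
    by (rule list_all2_keys[OF xs]) (use fs in \<open>auto simp: arity_ge_def\<close>)
  then have sub: "set xs \<subseteq> symbols P" and pos: "\<And>x. x \<in> set xs \<Longrightarrow> 1 \<le> length (snd x)" by blast+
  have "length xs = (\<Sum>x\<leftarrow>xs. 1)" by (simp add: sum_list_triv)
  also have "\<dots> \<le> (\<Sum>x\<leftarrow>xs. length (snd x))" by (rule sum_list_mono[OF pos])
  also have "\<dots> = length (snd (tcomp P \<mu> xs))" by (simp add: tcomp_def length_concat comp_def)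
  finally show "sg (tcomp P \<mu> xs) \<in> arity_ge (length fs)"
    using tcomp_closed[OF _ sub] \<mu> list_all2_lengthD[OF xs] by (simp add: arity_ge_def)
qed

text \<open>
  The Leibniz rule replaces one vector of a symbol by a value of \<open>\<gamma>\<close>, so by at least one vector.
\<close>

lemma der_formal_arity_ge:
  assumes \<gamma>: "\<And>v. \<gamma> v \<in> arity_ge 1" and f: "f \<in> arity_ge m"
  shows "der_formal \<gamma> f \<in> arity_ge m"
  unfolding der_formal_def
proof (rule lin_in_subspace[OF subspace_arity_ge])
  fix x assume "x \<in> Poly_Mapping.keys f"
  then have x: "x \<in> symbols P" "m \<le> length (snd x)" using f by (auto simp: arity_ge_def)
  have \<iota>: "\<iota> v \<in> arity_ge 1" for v using \<iota>s_closed by (simp add: arity_ge_def) (simp add: \<iota>s_def)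
  have "formal_op P (fst x) ((map \<iota> (snd x))[i := \<gamma> (snd x ! i)]) \<in> arity_ge (length (snd x))" for i
  proof -
    have "f \<in> arity_ge 1" if "f \<in> set ((map \<iota> (snd x))[i := \<gamma> (snd x ! i)])" for f
      using subsetD[OF set_update_subset_insert that] \<gamma> \<iota> by auto
    from formal_op_arity_ge[of "fst x" "(map \<iota> (snd x))[i := \<gamma> (snd x ! i)]", OF _ this]
    show ?thesis using x by (simp add: symbols_def split_def)
  qed
  then have "der_symbol \<gamma> x \<in> arity_ge (length (snd x))"
    unfolding der_symbol_def by (intro free.subspace_sum[OF subspace_arity_ge])
  then show "der_symbol \<gamma> x \<in> arity_ge m" using x(2) by (auto simp: arity_ge_def)
qed

definition positive :: "('r, 'o, 'v) fa_map set" where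
  "positive = {\<delta> g | g. \<forall>x. g x \<in> arity_ge 2}"

lemma sub_prelie_positive: "sub_prelie P sV positive"
proof -
  have cl: "g x \<in> formals" if "\<forall>x. g x \<in> arity_ge 2" for g and x :: 'v using that arity_ge_formals by blast
  have "arity_ge 2 \<subseteq> arity_ge 1" by (auto simp: arity_ge_def)
  have "d \<in> Der P sV" if pos: "d \<in> positive" for d
  proof -
    obtain g where "d = \<delta> g" "\<forall>x. g x \<in> arity_ge 2" using pos unfolding positive_def by blast
    then show ?thesis using \<delta>_Der[of g] cl[of g] by simp
  qed
  then have "positive \<subseteq> Der P sV" by blast
  moreover have "der_zero P sV \<in> positive"
    unfolding positive_def der_zero_\<delta> using free.subspace_0[OF subspace_arity_ge] by blast
  moreover have "der_add P sV d e \<in> positive" if pos: "d \<in> positive" "e \<in> positive" for d e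
  proof -
    obtain g h where *: "d = \<delta> g" "\<forall>x. g x \<in> arity_ge 2" "e = \<delta> h" "\<forall>x. h x \<in> arity_ge 2"
      using pos unfolding positive_def by blast
    have "der_add P sV d e = \<delta> (\<lambda>x. g x + h x)"
      unfolding * by (rule der_add_\<delta>) (use * cl in blast)+
    then show ?thesis using * free.subspace_add[OF subspace_arity_ge] unfolding positive_def by blast
  qed
  moreover have "der_scale P sV c d \<in> positive" if pos: "d \<in> positive" for c d
  proof -
    obtain g where *: "d = \<delta> g" "\<forall>x. g x \<in> arity_ge 2"
      using pos unfolding positive_def by blast
    have "der_scale P sV c d = \<delta> (\<lambda>x. free_scale c (g x))"
      unfolding * by (rule der_scale_\<delta>) (use * cl in blast)
    then show ?thesis using * free.subspace_scale[OF subspace_arity_ge] unfolding positive_def by blast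
  qed
  moreover have "der_prelie P sV d e \<in> positive" if pos: "d \<in> positive" "e \<in> positive" for d e
  proof -
    obtain g h where *: "d = \<delta> g" "\<forall>x. g x \<in> arity_ge 2" "e = \<delta> h" "\<forall>x. h x \<in> arity_ge 2"
      using pos unfolding positive_def by blast
    have "der_prelie P sV d e = \<delta> (\<lambda>x. der_formal (ext h) (g x))"
      unfolding * by (rule der_prelie_\<delta>) (use * cl in blast)+
    moreover have "der_formal (ext h) (g x) \<in> arity_ge 2" for x
    proof (rule der_formal_arity_ge)
      show "ext h v \<in> arity_ge 1" for v
        by (rule ext_in_subspace[OF subspace_arity_ge]) (use * \<open>arity_ge 2 \<subseteq> arity_ge 1\<close> in blast)
      show "g x \<in> arity_ge 2" using * by blast
    qed
    ultimately show ?thesis unfolding positive_def by blast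
  qed
  ultimately show ?thesis
    unfolding sub_prelie_def der_submodule_def by (intro conjI ballI allI)
qed

lemma Der_deg_1_positive: "Der_deg P sV 1 \<subseteq> positive"
proof
  fix d assume "d \<in> Der_deg P sV 1"
  then obtain g where g: "\<And>x. g x \<in> graded (1 + 1)" "d = \<delta> g" using Der_degE by blast
  have "graded (1 + 1) \<subseteq> arity_ge 2" by (auto simp: arity_ge_def symbols_def sym_tensors_def)
  then show "d \<in> positive" using g unfolding positive_def by blast
qed

text \<open>
  A value of arity at least two is a sum of symbols, each of which is homogeneous and so gives a
  derivation of some positive degree.
\<close>

lemma positive_in_submodule:
  assumes L: "der_submodule P sV L" and deg: "\<And>k. k \<ge> 1 \<Longrightarrow> Der_deg P sV k \<subseteq> L"
  shows "positive \<subseteq> L"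
proof
  fix d assume "d \<in> positive"
  then obtain g where d: "d = \<delta> g" and g: "\<And>x. g x \<in> arity_ge 2" unfolding positive_def by blast
  have E: "E x f \<in> L" if f: "f \<in> arity_ge 2" for x f
  proof -
    have "f \<in> {f \<in> formals. E x f \<in> L}"
    proof (rule free_subspace_induct[OF subspace_E[OF L]])
      fix y assume "y \<in> Poly_Mapping.keys f"
      then have y: "y \<in> symbols P" "2 \<le> length (snd y)" using f by (auto simp: arity_ge_def)
      have "sg y \<in> graded (length (snd y) - 1 + 1)"
      proof -
        have "length (snd y) - 1 + 1 = length (snd y)" using y(2) by linarith
        then show ?thesis using y(1) by (simp only:) (auto simp: symbols_def sym_tensors_def)
      qed
      then have "E x (sg y) \<in> Der_deg P sV (length (snd y) - 1)"
        by (intro Der_degI) (simp add: point_map_def)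
      then show "sg y \<in> {f \<in> formals. E x f \<in> L}"
        using subsetD[OF deg[of "length (snd y) - 1"]] y by simp
    qed
    then show ?thesis by simp
  qed
  show "d \<in> L"
    unfolding d by (rule \<delta>_in_submodule[OF L]) (use g arity_ge_formals in blast, rule E[OF g])
qed

end

theorem theorem2:
  fixes P :: "('r::comm_ring_1, 'o::ab_group_add) operad_data"
    and B :: "'b set"
    and sV :: "'r \<Rightarrow> 'v::ab_group_add \<Rightarrow> 'v"
    and r :: nat
  assumes "binary_operad B P"
    and "free_module_of_rank sV r"
    and "r \<noteq> 1"
  shows "Der_preLie1 P sV = Der_plus P sV"
proof -
  obtain X where X: "finite X" "card X = r" "\<not> module.dependent sV X" "module.span sV X = UNIV"
    and V: "module sV"
    using assms(2) unfolding free_module_of_rank_def by blast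
  obtain \<phi> where P: "symm_operad P" and \<phi>: "operad_hom (free_binary_operad B) P \<phi>"
    and surj: "\<And>n. \<phi> n ` ops (free_binary_operad B) n = ops P n"
    using assms(1) unfolding binary_operad_def by blast
  interpret binary_free_algebra_basis P sV X B \<phi>
    by (intro binary_free_algebra_basis.intro free_algebra_basis.intro binary_free_algebra.intro
        free_algebra.intro free_algebra_axioms.intro free_algebra_basis_axioms.intro
        binary_free_algebra_axioms.intro P \<phi> surj V X)
  have "Der_preLie1 P sV \<subseteq> positive"
    unfolding Der_preLie1_def using sub_prelie_positive Der_deg_1_positive by blast
  also have "positive \<subseteq> Der_plus P sV"
    unfolding Der_plus_def
  proof (rule Inter_greatest)
    fix L assume "L \<in> {L. der_submodule P sV L \<and> (\<Union>k\<in>{1..}. Der_deg P sV k) \<subseteq> L}"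
    then show "positive \<subseteq> L" by (intro positive_in_submodule) auto
  qed
  finally have "Der_preLie1 P sV \<subseteq> Der_plus P sV" .
  moreover have "Der_plus P sV \<subseteq> Der_preLie1 P sV"
    unfolding Der_preLie1_def
  proof (rule Inter_greatest)
    fix L assume "L \<in> {L. sub_prelie P sV L \<and> Der_deg P sV 1 \<subseteq> L}"
    then have L: "sub_prelie P sV L" "Der_deg P sV 1 \<subseteq> L" by blast+
    have "Der_deg P sV k \<subseteq> L" if "k \<ge> 1" for k
      by (rule Der_deg_generated[OF L _ that]) (use X assms(3) in simp)
    moreover have "der_submodule P sV L" using L unfolding sub_prelie_def by blast
    ultimately show "Der_plus P sV \<subseteq> L" unfolding Der_plus_def by (intro Inter_lower) auto
  qed
  ultimately show ?thesis by blast
qed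

end
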